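(* Let $\sigma$ be an irreducible incommensurable normalized multiscale substitution scheme in $\mathbb{R}^d$ with prototiles $T_1,\dots,T_n$ and constants of substitution $\alpha_{hj}^{(k)}$. For every $j=1,\dots,n$ and $0\le a<b\le1$, the volume covered by tiles of type $j$ in $F_t(T_i)$ with scale in $[a,b]$ (equivalently, with volume in $[a^d,b^d]$) grows as $$\nu_{j,[a,b]}\,e^{dt}+o(e^{dt}),\qquad t\to\infty,$$ independently of $i$, where $\nu_{j,[a,b]}:=\sum_{h=1}^n d_{hj,[a,b]}\,q_h$, $$d_{hj,[a,b]}:=\sum_{k=1}^{k_{hj}}\left(\alpha_{hj}^{(k)}\right)^d\log\frac{\mu_{hj}^{(k)}(b)}{\eta_{hj}^{(k)}(a)},\qquad \eta_{hj}^{(k)}(a):=\max\{a,\alpha_{hj}^{(k)}\},\quad \mu_{hj}^{(k)}(b):=\max\{b,\alpha_{hj}^{(k)}\},$$ and $q_h$ is the (common) value of the entries in column $h$ of the matrix $Q_\sigma$ defined in the context.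
   Context: Schemes. A tile in $\mathbb{R}^d$ is a bounded Lebesgue measurable set $T$ of positive measure $\mathrm{vol}\,T$ whose boundary has measure zero. A tessellation of $U\subset\mathbb{R}^d$ is a collection of tiles with pairwise disjoint interiors and union $U$; it is called a patch if $U$ is bounded ($U$ is then the support of the patch). A multiscale substitution scheme $\sigma=(\tau_\sigma,\varrho_\sigma)$ consists of a finite list of prototiles $\tau_\sigma=(T_1,\dots,T_n)$ and, for each $i$, a tessellation $\varrho_\sigma(T_i)$ of $T_i$ all of whose tiles are translates of rescaled prototiles; the list of these rescaled prototiles is $\omega_\sigma(T_i)=(\alpha_{ij}^{(k)}T_j:\ j=1,\dots,n,\ k=1,\dots,k_{ij})$. The numbers $\alpha_{ij}^{(k)}\in(0,1)$ are the constants of substitution. A translate of $\alpha T_j$, $\alpha>0$, is a tile of type $j$ and scale $\alpha$. Standing assumptions: $\sigma$ is normalized, i.e. $\mathrm{vol}\,T_i=1$ for all $i$; distinct prototiles are geometrically different ($T_i$ is not a rescaled copy of $T_j$ for $i\ne j$), so the type of a tile is determined by the tile. Substitution semi-flow. For $t\ge 0$, $F_t(T_i)$ is the patch supported on $e^tT_i$ obtained by starting with $e^tT_i$ and repeatedly substituting (according to the rescaled rule $\varrho_\sigma$) every tile of volume $>1$, until all tiles have volume $\le 1$. $\sigma$ is irreducible if for all $i,j$ there is $t>0$ such that $F_t(T_i)$ contains a tile of type $j$. $\sigma$ is incommensurable if there are $i,j$ and $t_1,t_2>0$ with $t_1\notin\mathbb{Q}t_2$ such that $F_{t_1}(T_i)$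 contains a tile of type $i$ and unit volume and $F_{t_2}(T_j)$ contains a tile of type $j$ and unit volume. Matrices. The graph matrix function $M_\sigma:\mathbb{C}\to M_n(\mathbb{C})$ has entries $(M_\sigma(s))_{ij}=\sum_{k=1}^{k_{ij}}(\alpha_{ij}^{(k)})^s$ (zero if $k_{ij}=0$), and $M_\sigma'$ is its entrywise derivative. Put $$Q_\sigma=\frac{\mathrm{adj}(I-M_\sigma(d))}{-\mathrm{tr}\big(\mathrm{adj}(I-M_\sigma(d))\cdot M_\sigma'(d)\big)},$$ where $\mathrm{adj}$ is the adjugate (for $n=1$ the $1\times1$ matrix $(1)$). $Q_\sigma$ is a positive rank $1$ matrix whose columns are multiples of $(1,\dots,1)^T$; $q_h$ denotes the number such that column $h$ of $Q_\sigma$ is $q_h\cdot(1,\dots,1)^T$. *)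

theory Defs
  imports
    "HOL-Analysis.Analysis"
    "HOL-Library.While_Combinator"
    "HOL-Library.Landau_Symbols"
    "Jordan_Normal_Form.Determinant"
begin

text \<open>The ambient space is a Euclidean space \<open>'a\<close>, so \<open>d\<close> is \<open>DIM('a)\<close>. All indices are
  zero-based: prototiles are \<open>T\<^sub>i\<close> with \<open>i < n\<close>, and the rescaled copies of \<open>T\<^sub>j\<close> in the
  substitution of \<open>T\<^sub>i\<close> are numbered by \<open>k < k\<^sub>i\<^sub>j\<close>.\<close>

definition is_tile :: "'a::euclidean_space set \<Rightarrow> bool" where
  "is_tile T \<longleftrightarrow> bounded T \<and> T \<in> sets lebesgue \<and> 0 < measure lebesgue T \<and>
     frontier T \<in> null_sets lebesgue"

definition tessellation :: "'a::euclidean_space set \<Rightarrow> 'a set set \<Rightarrow> bool" where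
  "tessellation U P \<longleftrightarrow> (\<forall>S\<in>P. is_tile S) \<and>
     (\<forall>S\<in>P. \<forall>S'\<in>P. S \<noteq> S' \<longrightarrow> interior S \<inter> interior S' = {}) \<and> \<Union>P = U"

definition scaled_copy :: "real \<Rightarrow> 'a::euclidean_space \<Rightarrow> 'a set \<Rightarrow> 'a set" where
  "scaled_copy \<alpha> v S = (\<lambda>x. v + \<alpha> *\<^sub>R x) ` S"

text \<open>The substitution rule is stored through the data of its tiles: \<open>mult \<sigma> i j\<close> is \<open>k\<^sub>i\<^sub>j\<close>,
  \<open>subst_const \<sigma> i j k\<close> is the constant of substitution with indices \<open>i\<close>, \<open>j\<close> and superscript
  \<open>k\<close>, and \<open>subst_shift \<sigma> i j k\<close> is the vector by which the corresponding rescaled prototile is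
  translated.\<close>

record 'a scheme =
  protos :: "'a set list"
  mult :: "nat \<Rightarrow> nat \<Rightarrow> nat"
  subst_const :: "nat \<Rightarrow> nat \<Rightarrow> nat \<Rightarrow> real"
  subst_shift :: "nat \<Rightarrow> nat \<Rightarrow> nat \<Rightarrow> 'a"

definition nprotos :: "'a::euclidean_space scheme \<Rightarrow> nat" where
  "nprotos \<sigma> = length (protos \<sigma>)"

definition proto :: "'a::euclidean_space scheme \<Rightarrow> nat \<Rightarrow> 'a set" where
  "proto \<sigma> i = protos \<sigma> ! i"

definition piece_index :: "'a::euclidean_space scheme \<Rightarrow> nat \<Rightarrow> (nat \<times> nat) set" where
  "piece_index \<sigma> i = {(j, k). j < nprotos \<sigma> \<and> k < mult \<sigma> i j}"

definition piece :: "'a::euclidean_space scheme \<Rightarrow> nat \<Rightarrow> nat \<times> nat \<Rightarrow> 'a set" where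
  "piece \<sigma> i = (\<lambda>(j, k). scaled_copy (subst_const \<sigma> i j k) (subst_shift \<sigma> i j k) (proto \<sigma> j))"

definition subst_rule :: "'a::euclidean_space scheme \<Rightarrow> nat \<Rightarrow> 'a set set" where
  "subst_rule \<sigma> i = piece \<sigma> i ` piece_index \<sigma> i"

text \<open>Injectivity of the enumeration says that the list of rescaled prototiles contains each tile
  of the tessellation of \<open>T\<^sub>i\<close> exactly once.\<close>

definition multiscale_scheme :: "'a::euclidean_space scheme \<Rightarrow> bool" where
  "multiscale_scheme \<sigma> \<longleftrightarrow>
     (\<forall>i<nprotos \<sigma>. is_tile (proto \<sigma> i)) \<and>
     (\<forall>i<nprotos \<sigma>. tessellation (proto \<sigma> i) (subst_rule \<sigma> i)) \<and>
     (\<forall>i<nprotos \<sigma>. inj_on (piece \<sigma> i) (piece_index \<sigma> i)) \<and>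
     (\<forall>i<nprotos \<sigma>. \<forall>j<nprotos \<sigma>. \<forall>k<mult \<sigma> i j. subst_const \<sigma> i j k \<in> {0<..<1})"

definition normalized_scheme :: "'a::euclidean_space scheme \<Rightarrow> bool" where
  "normalized_scheme \<sigma> \<longleftrightarrow> (\<forall>i<nprotos \<sigma>. measure lebesgue (proto \<sigma> i) = 1)"

text \<open>A ``rescaled copy'' is understood up to translation, as is needed for the type of a tile to
  be determined by the tile.\<close>

definition geometrically_distinct :: "'a::euclidean_space scheme \<Rightarrow> bool" where
  "geometrically_distinct \<sigma> \<longleftrightarrow>
     (\<forall>i<nprotos \<sigma>. \<forall>j<nprotos \<sigma>. i \<noteq> j \<longrightarrow>
        \<not> (\<exists>\<alpha>>0. \<exists>v. proto \<sigma> i = scaled_copy \<alpha> v (proto \<sigma> j)))"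

definition tile_of_type :: "'a::euclidean_space scheme \<Rightarrow> nat \<Rightarrow> real \<Rightarrow> 'a set \<Rightarrow> bool" where
  "tile_of_type \<sigma> j \<alpha> S \<longleftrightarrow> j < nprotos \<sigma> \<and> 0 < \<alpha> \<and> (\<exists>v. S = scaled_copy \<alpha> v (proto \<sigma> j))"

text \<open>For geometrically distinct prototiles of volume one the representation of \<open>S\<close> below as
  \<open>v + \<alpha> T\<^sub>j\<close> is unique, so this is the correspondingly rescaled and translated copy of the
  substitution rule of \<open>T\<^sub>j\<close>.\<close>

definition subst_tile :: "'a::euclidean_space scheme \<Rightarrow> 'a set \<Rightarrow> 'a set set" where
  "subst_tile \<sigma> S = {scaled_copy \<alpha> v P | j \<alpha> v P.
     j < nprotos \<sigma> \<and> 0 < \<alpha> \<and> S = scaled_copy \<alpha> v (proto \<sigma> j) \<and> P \<in> subst_rule \<sigma> j}"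

definition subst_step :: "'a::euclidean_space scheme \<Rightarrow> 'a set set \<Rightarrow> 'a set set" where
  "subst_step \<sigma> P = (\<Union>S\<in>P. if measure lebesgue S > 1 then subst_tile \<sigma> S else {S})"

definition flow :: "'a::euclidean_space scheme \<Rightarrow> real \<Rightarrow> nat \<Rightarrow> 'a set set" where
  "flow \<sigma> t i = while (\<lambda>P. \<exists>S\<in>P. measure lebesgue S > 1) (subst_step \<sigma>)
     {scaled_copy (exp t) 0 (proto \<sigma> i)}"

definition irreducible_scheme :: "'a::euclidean_space scheme \<Rightarrow> bool" where
  "irreducible_scheme \<sigma> \<longleftrightarrow>
     (\<forall>i<nprotos \<sigma>. \<forall>j<nprotos \<sigma>. \<exists>t>0. \<exists>S\<in>flow \<sigma> t i. \<exists>\<alpha>. tile_of_type \<sigma> j \<alpha> S)"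

definition unit_return :: "'a::euclidean_space scheme \<Rightarrow> nat \<Rightarrow> real \<Rightarrow> bool" where
  "unit_return \<sigma> i t \<longleftrightarrow>
     (\<exists>S\<in>flow \<sigma> t i. (\<exists>\<alpha>. tile_of_type \<sigma> i \<alpha> S) \<and> measure lebesgue S = 1)"

definition incommensurable_scheme :: "'a::euclidean_space scheme \<Rightarrow> bool" where
  "incommensurable_scheme \<sigma> \<longleftrightarrow>
     (\<exists>i<nprotos \<sigma>. \<exists>j<nprotos \<sigma>. \<exists>t1>0. \<exists>t2>0. \<not> (\<exists>q\<in>\<rat>. t1 = q * t2) \<and>
        unit_return \<sigma> i t1 \<and> unit_return \<sigma> j t2)"

definition graph_matrix :: "'a::euclidean_space scheme \<Rightarrow> complex \<Rightarrow> complex mat" where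
  "graph_matrix \<sigma> s = mat (nprotos \<sigma>) (nprotos \<sigma>)
     (\<lambda>(i, j). \<Sum>k<mult \<sigma> i j. complex_of_real (subst_const \<sigma> i j k) powr s)"

definition graph_matrix_deriv :: "'a::euclidean_space scheme \<Rightarrow> complex \<Rightarrow> complex mat" where
  "graph_matrix_deriv \<sigma> s = mat (nprotos \<sigma>) (nprotos \<sigma>)
     (\<lambda>(i, j). deriv (\<lambda>z. graph_matrix \<sigma> z $$ (i, j)) s)"

definition mat_trace :: "'b::comm_monoid_add mat \<Rightarrow> 'b" where
  "mat_trace A = (\<Sum>i<dim_row A. A $$ (i, i))"

definition Q_matrix :: "'a::euclidean_space scheme \<Rightarrow> complex mat" where
  "Q_matrix \<sigma> =
    (let s = of_nat DIM('a);
         A = adj_mat (1\<^sub>m (nprotos \<sigma>) - graph_matrix \<sigma> s)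
     in (1 / - mat_trace (A * graph_matrix_deriv \<sigma> s)) \<cdot>\<^sub>m A)"

definition q_entry :: "'a::euclidean_space scheme \<Rightarrow> nat \<Rightarrow> real" where
  "q_entry \<sigma> h = (THE q. \<forall>i<nprotos \<sigma>. Q_matrix \<sigma> $$ (i, h) = complex_of_real q)"

definition d_coeff :: "'a::euclidean_space scheme \<Rightarrow> nat \<Rightarrow> nat \<Rightarrow> real \<Rightarrow> real \<Rightarrow> real" where
  "d_coeff \<sigma> h j a b = (\<Sum>k<mult \<sigma> h j. subst_const \<sigma> h j k ^ DIM('a) *
     ln (max b (subst_const \<sigma> h j k) / max a (subst_const \<sigma> h j k)))"

definition nu_coeff :: "'a::euclidean_space scheme \<Rightarrow> nat \<Rightarrow> real \<Rightarrow> real \<Rightarrow> real" where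
  "nu_coeff \<sigma> j a b = (\<Sum>h<nprotos \<sigma>. d_coeff \<sigma> h j a b * q_entry \<sigma> h)"

definition covered_volume ::
  "'a::euclidean_space scheme \<Rightarrow> nat \<Rightarrow> nat \<Rightarrow> real \<Rightarrow> real \<Rightarrow> real \<Rightarrow> real" where
  "covered_volume \<sigma> i j a b t =
     measure lebesgue (\<Union>{S \<in> flow \<sigma> t i. \<exists>\<alpha>\<in>{a..b}. tile_of_type \<sigma> j \<alpha> S})"

end

theory Submission
  imports Defs
begin

text \<open>Choose a point of the tile \<open>e\<^sup>t T\<^sub>i\<close> uniformly at random and follow the tile that contains it while the
  tiles of volume greater than one are substituted. From a tile of type \<open>h\<close> the point moves to the piece
  of index \<open>e\<close> with probability \<open>\<alpha>\<^sup>d\<close>, the volume of that piece, and the logarithm of the scale drops by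
  \<open>- ln \<alpha>\<close>. The types form a finite Markov chain with holding times \<open>- ln \<alpha>\<close>, and in the final
  patch the point lies in the tile reached at the first time when the accumulated delay is at least
  \<open>t\<close>. The covered volume divided by \<open>e\<^sup>d\<^sup>t\<close> is therefore the probability that this first passage
  happens into type \<open>j\<close> with a prescribed overshoot. Such a passage through a piece of scale \<open>\<alpha>\<close> of a
  tile of type \<open>h\<close> happens exactly when the time left on reaching that tile lies in an interval with
  end points \<open>ln (max a \<alpha> / \<alpha>)\<close> and \<open>ln (max b \<alpha> / \<alpha>)\<close>; its length, weighted by \<open>\<alpha>\<^sup>d\<close> and summed, is
  \<open>d\<^sub>h\<^sub>j\<close>. Asymptotically the times left are spread uniformly, with density \<open>q\<^sub>h\<close> for the type \<open>h\<close>.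

  This equidistribution is a Markov renewal theorem, and it is proved by real-variable arguments. Let \<open>W\<close>
  solve the renewal equation with a Lipschitz source \<open>z\<close> of compact support, and let \<open>M\<close> be the upper
  limit of \<open>W\<close> over all types. Past the support of \<open>z\<close> each value of \<open>W\<close> is a weighted mean of earlier
  values, so \<open>W\<close> is bounded and uniformly continuous (\<open>maximum_principle\<close>), and a value close to
  \<open>M\<close> at time \<open>t\<close> forces values close to \<open>M\<close> at every time \<open>t - s\<close> where \<open>s\<close> is the length of a
  path (\<open>path_transmits\<close>). Two loops of incommensurable lengths make the path lengths asymptotically dense
  (\<open>path_lengths_dense\<close>). Hence \<open>W\<close> is close to \<open>M\<close> on whole windows of time, for all types at once
  (\<open>near_limsup_on_window\<close>). For a left-invariant vector \<open>\<pi>\<close> the renewal equation has a conserved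
  quantity, an integral of \<open>W\<close> over such windows, whose value is \<open>\<Sum>\<^sub>i \<pi>\<^sub>i \<integral>z\<^sub>i\<close> (\<open>conservation\<close>). So \<open>M\<close>
  is this mass divided by the mean delay; applied to \<open>- z\<close>, the same argument computes the lower limit,
  which is thus equal to \<open>M\<close>, and \<open>W\<close> converges (\<open>key_renewal\<close>).

  The invariant vector is a row of \<open>adj (I - M\<^sub>\<sigma>(d))\<close>. The matrix \<open>M\<^sub>\<sigma>(d)\<close> is stochastic and irreducible,
  hence the kernel of \<open>I - M\<^sub>\<sigma>(d)\<close> consists of the constant vectors and a principal minor does not vanish:
  both follow from the maximum principle for functions that are harmonic off one state
  (\<open>harmonic_constant\<close>). The trace in the denominator of \<open>Q\<^sub>\<sigma>\<close> is minus the mean delay. Finally the source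
  that belongs to the covered volume is a sum of indicator functions of intervals, squeezed between
  trapezoids of almost the same mass (\<open>source_approximation\<close>).\<close>

section \<open>Markov renewal equations\<close>

locale markov_renewal =
  fixes S :: "'s set" and E :: "'s \<Rightarrow> 'e set" and tgt :: "'e \<Rightarrow> 's"
    and p len :: "'s \<Rightarrow> 'e \<Rightarrow> real" and lmin lmax :: real
  assumes finite_S: "finite S"
    and finite_E: "i \<in> S \<Longrightarrow> finite (E i)"
    and tgt_S: "i \<in> S \<Longrightarrow> e \<in> E i \<Longrightarrow> tgt e \<in> S"
    and p_pos: "i \<in> S \<Longrightarrow> e \<in> E i \<Longrightarrow> 0 < p i e"
    and p_sum: "i \<in> S \<Longrightarrow> (\<Sum>e\<in>E i. p i e) = 1"
    and lmin_pos: "0 < lmin"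
    and len_ge: "i \<in> S \<Longrightarrow> e \<in> E i \<Longrightarrow> lmin \<le> len i e"
    and len_le: "i \<in> S \<Longrightarrow> e \<in> E i \<Longrightarrow> len i e \<le> lmax"
begin

text \<open>A Markov renewal equation with source \<open>z\<close> reads \<open>f = z + transfer f\<close>.\<close>

definition transfer :: "('s \<Rightarrow> real \<Rightarrow> real) \<Rightarrow> 's \<Rightarrow> real \<Rightarrow> real" where
  "transfer f i t = (\<Sum>e\<in>E i. p i e * f (tgt e) (t - len i e))"

text \<open>The applied form, which as a rewrite rule leaves the powers \<open>transfer ^^ n\<close> folded.\<close>

lemma transfer_apply: "transfer f i t = (\<Sum>e\<in>E i. p i e * f (tgt e) (t - len i e))"
  by (fact transfer_def)

lemma transfer_cong:
  "(\<And>e. e \<in> E i \<Longrightarrow> f (tgt e) (t - len i e) = g (tgt e) (t - len i e)) \<Longrightarrow> transfer f i t = transfer g i t"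
  by (simp add: transfer_apply)

lemma transfer_le_const:
  assumes "i \<in> S" and "\<And>e. e \<in> E i \<Longrightarrow> f (tgt e) (t - len i e) \<le> C"
  shows "transfer f i t \<le> C"
proof -
  have "transfer f i t \<le> (\<Sum>e\<in>E i. p i e * C)"
    unfolding transfer_def using assms p_pos by (intro sum_mono mult_left_mono) (auto simp: less_imp_le)
  also have "\<dots> = C" using p_sum[OF assms(1)] by (simp add: sum_distrib_right[symmetric])
  finally show ?thesis .
qed

lemma transfer_diff: "transfer (\<lambda>i t. f i t - g i t) i t = transfer f i t - transfer g i t"
  unfolding transfer_def by (simp add: right_diff_distrib sum_subtractf)

lemma transfer_uminus: "transfer (\<lambda>i t. - f i t) i t = - transfer f i t"
  unfolding transfer_def by (simp add: sum_negf)

lemma transfer_sum: "transfer (\<lambda>i t. \<Sum>n\<in>A. f n i t) i t = (\<Sum>n\<in>A. transfer (f n) i t)"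
  unfolding transfer_def sum_distrib_left by (rule sum.swap)

lemma transfer_shift: "transfer (\<lambda>i t. f i (t + h)) i t = transfer f i (t + h)"
  unfolding transfer_def by (simp add: algebra_simps)

text \<open>Every edge goes back in time by at least \<open>lmin\<close>, so a bound on the past propagates forward in steps
  of length \<open>lmin\<close>. This replaces compactness throughout: boundedness, equicontinuity and comparison
  of solutions are all obtained by applying it to suitable functions.\<close>

lemma maximum_principle:
  assumes initial: "\<And>i t. i \<in> S \<Longrightarrow> t \<le> T \<Longrightarrow> f i t \<le> C"
    and sub: "\<And>i t. i \<in> S \<Longrightarrow> T < t \<Longrightarrow> f i t \<le> transfer f i t"
    and i: "i \<in> S"
  shows "f i t \<le> C"
proof -
  have step: "\<forall>i\<in>S. \<forall>t\<le>T + real n * lmin. f i t \<le> C" for n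
  proof (induction n)
    case 0
    show ?case using initial by simp
  next
    case (Suc n)
    show ?case
    proof (intro ballI allI impI)
      fix i t assume i: "i \<in> S" and t: "t \<le> T + real (Suc n) * lmin"
      show "f i t \<le> C"
      proof (cases "t \<le> T")
        case True then show ?thesis using initial i by simp
      next
        case False
        have "t - len i e \<le> T + real n * lmin" if "e \<in> E i" for e
          using t len_ge[OF i that] by (simp add: algebra_simps)
        then have "transfer f i t \<le> C"
          using Suc tgt_S[OF i] by (intro transfer_le_const[OF i]) auto
        moreover have "f i t \<le> transfer f i t" using sub[OF i] False by simp
        ultimately show ?thesis by linarith
      qed
    qed
  qed
  obtain n where "(t - T) / lmin \<le> real n" using real_arch_simple by blast
  then have "t \<le> T + real n * lmin" using lmin_pos by (simp add: field_simps)
  then show ?thesis using step i by blast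
qed

text \<open>The Neumann series that solves the renewal equation. For a source that vanishes at early times only
  finitely many terms contribute at any given time, because \<open>n\<close> steps take at least \<open>n * lmin\<close>.\<close>

definition potential :: "('s \<Rightarrow> real \<Rightarrow> real) \<Rightarrow> 's \<Rightarrow> real \<Rightarrow> real" where
  "potential z i t = (\<Sum>n. (transfer ^^ n) z i t)"

lemma transfer_power_vanishes:
  assumes "\<And>i t. i \<in> S \<Longrightarrow> t < c \<Longrightarrow> z i t = 0" and "i \<in> S" and "t < c + real n * lmin"
  shows "(transfer ^^ n) z i t = 0"
  using assms(2,3)
proof (induction n arbitrary: i t)
  case 0 then show ?case using assms(1) by simp
next
  case (Suc n)
  have "(transfer ^^ n) z (tgt e) (t - len i e) = 0" if "e \<in> E i" for e
    using Suc.prems len_ge[OF _ that] tgt_S[OF _ that]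
    by (intro Suc.IH) (fastforce simp: algebra_simps)+
  then have "transfer ((transfer ^^ n) z) i t = 0" by (simp add: transfer_apply)
  then show ?case by simp
qed

lemma potential_eq_sum:
  assumes "\<And>i t. i \<in> S \<Longrightarrow> t < c \<Longrightarrow> z i t = 0" and "i \<in> S" and "t < c + real N * lmin"
  shows "potential z i t = (\<Sum>n<N. (transfer ^^ n) z i t)"
  unfolding potential_def
proof (rule suminf_finite)
  fix n assume "n \<notin> {..<N}"
  then have "real N * lmin \<le> real n * lmin" using lmin_pos by (intro mult_right_mono) auto
  then show "(transfer ^^ n) z i t = 0"
    using assms by (intro transfer_power_vanishes[of c]) auto
qed simp

lemma potential_vanishes:
  assumes "\<And>i t. i \<in> S \<Longrightarrow> t < c \<Longrightarrow> z i t = 0" and "i \<in> S" and "t < c"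
  shows "potential z i t = 0"
  using potential_eq_sum[of c z i t 0] assms by simp

lemma exists_bound_nat: "\<exists>N. t < c + real N * lmin"
proof -
  obtain N where "(t - c) / lmin < real N" using reals_Archimedean2 by blast
  then show ?thesis using lmin_pos by (auto simp: field_simps)
qed

lemma renewal_equation:
  assumes z: "\<And>i t. i \<in> S \<Longrightarrow> t < c \<Longrightarrow> z i t = 0" and i: "i \<in> S"
  shows "potential z i t = z i t + transfer (potential z) i t"
proof -
  obtain N where N: "t < c + real N * lmin" using exists_bound_nat by blast
  have "potential z i t = (\<Sum>n<Suc N. (transfer ^^ n) z i t)"
    using N lmin_pos by (intro potential_eq_sum[OF z i]) (auto simp: algebra_simps)
  also have "\<dots> = z i t + (\<Sum>n<N. transfer ((transfer ^^ n) z) i t)"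
    by (subst sum.lessThan_Suc_shift) simp
  also have "(\<Sum>n<N. transfer ((transfer ^^ n) z) i t)
      = transfer (\<lambda>i t. \<Sum>n<N. (transfer ^^ n) z i t) i t"
    by (simp add: transfer_sum)
  also have "\<dots> = transfer (potential z) i t"
  proof (rule transfer_cong)
    fix e assume e: "e \<in> E i"
    have "t - len i e < c + real N * lmin" using N len_ge[OF i e] lmin_pos by linarith
    then show "(\<Sum>n<N. (transfer ^^ n) z (tgt e) (t - len i e))
        = potential z (tgt e) (t - len i e)"
      using potential_eq_sum[OF z tgt_S[OF i e]] by simp
  qed
  finally show ?thesis .
qed

lemma transfer_power_bound:
  assumes "\<And>i t. i \<in> S \<Longrightarrow> z i t \<le> B" and "i \<in> S"
  shows "(transfer ^^ n) z i t \<le> B"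
  using assms(2)
proof (induction n arbitrary: i t)
  case (Suc n) then show ?case using tgt_S by (auto intro!: transfer_le_const)
qed (use assms in auto)

lemma transfer_power_lipschitz:
  assumes "\<And>i s t. i \<in> S \<Longrightarrow> z i s - z i t \<le> K * \<bar>s - t\<bar>" and "i \<in> S"
  shows "(transfer ^^ n) z i s - (transfer ^^ n) z i t \<le> K * \<bar>s - t\<bar>"
  using assms(2)
proof (induction n arbitrary: i s t)
  case (Suc n)
  let ?f = "(transfer ^^ n) z" and ?h = "s - t"
  have "transfer ?f i s - transfer ?f i t = transfer (\<lambda>i t. ?f i (t + ?h) - ?f i t) i t"
    using transfer_shift[of ?f ?h i t] by (simp add: transfer_diff)
  also have "\<dots> \<le> K * \<bar>s - t\<bar>"
    using Suc.IH[OF tgt_S[OF Suc.prems]]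
    by (intro transfer_le_const[OF Suc.prems]) (smt (verit, best))
  finally show ?case by simp
qed (use assms in auto)

lemma potential_le_initial:
  assumes z: "\<And>i t. i \<in> S \<Longrightarrow> t < c \<Longrightarrow> z i t = 0"
    and B: "\<And>i t. i \<in> S \<Longrightarrow> z i t \<le> B" and i: "i \<in> S" and t: "t < c + real N * lmin"
  shows "potential z i t \<le> real N * B"
  using sum_bounded_above[of "{..<N}" "\<lambda>n. (transfer ^^ n) z i t" B] transfer_power_bound[of z B, OF B i]
    potential_eq_sum[OF z i t]
  by simp

text \<open>The lower end \<open>-1\<close> of the support leaves room on the left of time zero for the
  approximation of a source that jumps at time zero.\<close>

definition test_fun :: "real \<Rightarrow> real \<Rightarrow> ('s \<Rightarrow> real \<Rightarrow> real) \<Rightarrow> bool" where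
  "test_fun b K z \<longleftrightarrow> 0 \<le> b \<and> 0 \<le> K \<and> (\<forall>i\<in>S. \<forall>t. t < -1 \<or> b < t \<longrightarrow> z i t = 0) \<and>
     (\<forall>i\<in>S. \<forall>s t. \<bar>z i s - z i t\<bar> \<le> K * \<bar>s - t\<bar>)"

lemma test_fun_uminus: "test_fun b K z \<Longrightarrow> test_fun b K (\<lambda>i t. - z i t)"
  unfolding test_fun_def by (auto simp: abs_minus_commute)

lemma test_fun_bound:
  assumes "test_fun b K z" and "i \<in> S"
  shows "\<bar>z i t\<bar> \<le> K * (b + 2)"
proof (cases "t < -1 \<or> b < t")
  case True then show ?thesis using assms by (auto simp: test_fun_def)
next
  case False
  have "\<bar>z i t - z i (-2)\<bar> \<le> K * \<bar>t - (-2)\<bar>" "z i (-2) = 0"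
    using assms unfolding test_fun_def by (blast, auto)
  moreover have "K * \<bar>t - (-2)\<bar> \<le> K * (b + 2)"
    using False assms by (intro mult_left_mono) (auto simp: test_fun_def)
  ultimately show ?thesis by linarith
qed

lemma test_fun_renewal_equation:
  assumes "test_fun b K z" and "i \<in> S"
  shows "potential z i t = z i t + transfer (potential z) i t"
  using renewal_equation[of "-1" z i t] assms by (simp add: test_fun_def)

lemma homogeneous_after_support:
  assumes "test_fun b K z" and "i \<in> S" and "b < t"
  shows "potential z i t = transfer (potential z) i t"
  using test_fun_renewal_equation[OF assms(1,2)] assms by (simp add: test_fun_def)

lemma test_fun_potential_vanishes:
  assumes "test_fun b K z" and "i \<in> S" and "t < -1"
  shows "potential z i t = 0"
  using potential_vanishes[of "-1" z i t] assms by (simp add: test_fun_def)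

lemma potential_uminus:
  assumes "test_fun b K z" and "i \<in> S"
  shows "potential (\<lambda>i t. - z i t) i t = - potential z i t"
proof -
  have m: "(transfer ^^ n) (\<lambda>i t. - z i t) = (\<lambda>i t. - (transfer ^^ n) z i t)" for n
  proof (induction n)
    case (Suc n)
    have "transfer (\<lambda>i t. - (transfer ^^ n) z i t) = (\<lambda>i t. - transfer ((transfer ^^ n) z) i t)"
      by (intro ext) (rule transfer_uminus)
    then show ?case using Suc by simp
  qed simp
  obtain N where "t < -1 + real N * lmin" using exists_bound_nat by blast
  then show ?thesis
    using assms potential_eq_sum[of "-1" z i t N] potential_eq_sum[of "-1" "\<lambda>i t. - z i t" i t N]
    by (simp add: test_fun_def m sum_negf)
qed

lemma potential_bounded_above:
  assumes z: "test_fun b K z"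
  shows "\<exists>C. \<forall>i\<in>S. \<forall>t. potential z i t \<le> C"
proof -
  obtain N where N: "b < -1 + real N * lmin" using exists_bound_nat by blast
  have "potential z i t \<le> real N * (K * (b + 2))" if "i \<in> S" for i t
  proof (rule maximum_principle[where T = b and f = "potential z"])
    fix i t assume i: "i \<in> S" and "t \<le> b"
    then show "potential z i t \<le> real N * (K * (b + 2))"
      using N z test_fun_bound[OF z]
      by (intro potential_le_initial[of "-1"]) (auto simp: test_fun_def abs_le_iff)
  qed (use homogeneous_after_support[OF z] that in auto)
  then show ?thesis by blast
qed

lemma potential_bounded:
  assumes z: "test_fun b K z"
  shows "\<exists>C. \<forall>i\<in>S. \<forall>t. \<bar>potential z i t\<bar> \<le> C"
proof -
  obtain C where C: "\<forall>i\<in>S. \<forall>t. potential z i t \<le> C"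
    using potential_bounded_above[OF z] by blast
  obtain C' where C': "\<forall>i\<in>S. \<forall>t. - potential z i t \<le> C'"
    using potential_bounded_above[OF test_fun_uminus[OF z]] potential_uminus[OF z] by auto
  have "\<forall>i\<in>S. \<forall>t. \<bar>potential z i t\<bar> \<le> max C C'" by (meson C C' abs_le_iff max.coboundedI1 max.coboundedI2)
  then show ?thesis by blast
qed

text \<open>The increments \<open>W(t + h) - W(t)\<close> solve the homogeneous equation after the support of the source, so
  it suffices to bound them up to that time, where finitely many terms of the series, all with the
  Lipschitz constant of \<open>z\<close>, contribute.\<close>

lemma potential_lipschitz_upper:
  assumes z: "test_fun b K z"
  shows "\<exists>K'\<ge>0. \<forall>i\<in>S. \<forall>t. \<forall>h\<in>{0..1}. potential z i (t + h) - potential z i t \<le> K' * h"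
proof -
  obtain N where N: "b + 1 < -1 + real N * lmin" using exists_bound_nat by blast
  have z0: "\<And>i t. i \<in> S \<Longrightarrow> t < -1 \<Longrightarrow> z i t = 0" using z by (simp add: test_fun_def)
  have "potential z i (t + h) - potential z i t \<le> real N * K * h" if "i \<in> S" "h \<in> {0..1}" for i t h
  proof (rule maximum_principle[where T = b and f = "\<lambda>i t. potential z i (t + h) - potential z i t"])
    fix i t assume i: "i \<in> S" and t: "t \<le> b"
    have "potential z i (t + h) - potential z i t
        = (\<Sum>n<N. (transfer ^^ n) z i (t + h) - (transfer ^^ n) z i t)"
      using N t that by (subst (1 2) potential_eq_sum[OF z0 i, where N = N]) (auto simp: sum_subtractf)
    also have "\<dots> \<le> (\<Sum>n<N. K * \<bar>t + h - t\<bar>)"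
      using z i by (intro sum_mono transfer_power_lipschitz) (auto simp: test_fun_def abs_le_iff)
    finally show "potential z i (t + h) - potential z i t \<le> real N * K * h" using that by simp
  next
    fix i t assume "i \<in> S" "b < t"
    then show "potential z i (t + h) - potential z i t
        \<le> transfer (\<lambda>i t. potential z i (t + h) - potential z i t) i t"
      using that homogeneous_after_support[OF z, of i t] homogeneous_after_support[OF z, of i "t + h"]
      by (simp add: transfer_diff transfer_shift)
  qed (use that in auto)
  moreover have "0 \<le> real N * K" using z by (simp add: test_fun_def)
  ultimately show ?thesis by blast
qed

lemma potential_lipschitz:
  assumes z: "test_fun b K z"
  shows "\<exists>K'\<ge>0. \<forall>i\<in>S. \<forall>s t. \<bar>s - t\<bar> \<le> 1 \<longrightarrow> \<bar>potential z i s - potential z i t\<bar> \<le> K' * \<bar>s - t\<bar>"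
proof -
  obtain K1 where K1: "K1 \<ge> 0"
    "\<And>i t h. i \<in> S \<Longrightarrow> h \<in> {0..1} \<Longrightarrow> potential z i (t + h) - potential z i t \<le> K1 * h"
    using potential_lipschitz_upper[OF z] by blast
  obtain K2 where K2: "K2 \<ge> 0"
    "\<And>i t h. i \<in> S \<Longrightarrow> h \<in> {0..1} \<Longrightarrow> potential z i t - potential z i (t + h) \<le> K2 * h"
    using potential_lipschitz_upper[OF test_fun_uminus[OF z]] by (auto simp: potential_uminus[OF z])
  have ord: "\<bar>potential z i s - potential z i t\<bar> \<le> (K1 + K2) * (s - t)"
    if "i \<in> S" "t \<le> s" "s - t \<le> 1" for i s t
  proof -
    have "potential z i s - potential z i t \<le> K1 * (s - t)"
      "potential z i t - potential z i s \<le> K2 * (s - t)"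
      using K1(2)[of i "s - t" t] K2(2)[of i "s - t" t] that by auto
    moreover have "0 \<le> K1 * (s - t)" "0 \<le> K2 * (s - t)" using that K1 K2 by auto
    ultimately show ?thesis unfolding distrib_right by linarith
  qed
  have "\<bar>potential z i s - potential z i t\<bar> \<le> (K1 + K2) * \<bar>s - t\<bar>"
    if "i \<in> S" "\<bar>s - t\<bar> \<le> 1" for i s t
    using ord[of i s t] ord[of i t s] that by (cases "t \<le> s") (auto simp: abs_minus_commute)
  moreover have "K1 + K2 \<ge> 0" using K1 K2 by simp
  ultimately show ?thesis by blast
qed

lemma potential_continuous:
  assumes z: "test_fun b K z" and i: "i \<in> S"
  shows "continuous_on A (potential z i)"
proof -
  obtain K' where K': "K' \<ge> 0" "\<And>s t. \<bar>s - t\<bar> \<le> 1 \<Longrightarrow>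
      \<bar>potential z i s - potential z i t\<bar> \<le> K' * \<bar>s - t\<bar>"
    using potential_lipschitz[OF z] i by blast
  have "isCont (potential z i) t" for t
    unfolding continuous_at_eps_delta dist_norm
  proof (intro allI impI)
    fix \<epsilon> :: real assume \<epsilon>: "0 < \<epsilon>"
    show "\<exists>d>0. \<forall>x'. norm (x' - t) < d \<longrightarrow> norm (potential z i x' - potential z i t) < \<epsilon>"
    proof (intro exI[of _ "min 1 (\<epsilon> / (K' + 1))"] conjI allI impI)
      fix s assume s: "norm (s - t) < min 1 (\<epsilon> / (K' + 1))"
      then have "\<bar>potential z i s - potential z i t\<bar> \<le> K' * \<bar>s - t\<bar>" using K'(2) by simp
      also have "\<dots> \<le> (K' + 1) * \<bar>s - t\<bar>" by (simp add: distrib_right)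
      also have "\<dots> < \<epsilon>" using s K'(1) by (simp add: field_simps)
      finally show "norm (potential z i s - potential z i t) < \<epsilon>" by simp
    qed (use \<epsilon> K' in auto)
  qed
  then show ?thesis by (simp add: continuous_at_imp_continuous_on)
qed

end

section \<open>Path lengths and the propagation of near-maximal values\<close>

text \<open>Trading \<open>b\<close> for \<open>a\<close> one at a time moves the sum in steps of length \<open>a - b < \<delta>\<close>. With enough copies the
  steps cover an interval of length at least \<open>w\<close>, and multiples of \<open>w\<close> translate that interval over a
  half-line.\<close>

lemma nonneg_combinations_dense_aux:
  fixes a b w \<delta> :: real
  assumes "b < a" "a - b < \<delta>" "0 < w"
  obtains N :: nat and A where
    "\<And>x. A \<le> x \<Longrightarrow> \<exists>k\<le>N. \<exists>n::nat. \<bar>real (N - k) * b + real k * a + real n * w - x\<bar> < \<delta>"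
proof -
  define g where "g = a - b"
  have g: "0 < g" "g < \<delta>" using assms by (auto simp: g_def)
  obtain N :: nat where "w / g \<le> real N" using real_arch_simple by blast
  then have N: "w \<le> real N * g" using g by (simp add: field_simps)
  have "\<exists>k\<le>N. \<exists>n::nat. \<bar>real (N - k) * b + real k * a + real n * w - x\<bar> < \<delta>"
    if x: "real N * b \<le> x" for x
  proof -
    define n where "n = nat \<lfloor>(x - real N * b) / w\<rfloor>"
    define r where "r = x - real N * b - real n * w"
    have "0 \<le> (x - real N * b) / w" using x assms(3) by simp
    then have n: "real n \<le> (x - real N * b) / w" "(x - real N * b) / w < real n + 1"
      unfolding n_def by linarith+
    then have r: "0 \<le> r" "r < w" using assms(3) by (auto simp: r_def field_simps)
    define k where "k = nat \<lfloor>r / g\<rfloor>"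
    have "0 \<le> r / g" using r g by simp
    then have k: "real k \<le> r / g" "r / g < real k + 1" unfolding k_def by linarith+
    then have kg: "real k * g \<le> r" "r < real k * g + g" using g by (auto simp: field_simps)
    then have "real k * g < real N * g" using N r by linarith
    then have kN: "k \<le> N" using g by simp
    have "real (N - k) * b + real k * a = real N * b + real k * g"
      using kN by (simp add: g_def of_nat_diff algebra_simps)
    then have "\<bar>real (N - k) * b + real k * a + real n * w - x\<bar> < \<delta>"
      using kg g r_def by linarith
    then show ?thesis using kN by blast
  qed
  then show ?thesis using that by blast
qed

text \<open>Dirichlet's theorem provides positive multiples \<open>a\<close> of \<open>u\<close> and \<open>b\<close> of \<open>v\<close> that are distinct but closer
  than \<open>\<delta>\<close>. Which of them is larger is unknown, hence the two symmetric cases.\<close>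

lemma nonneg_combinations_dense:
  fixes u v \<delta> :: real
  assumes uv: "0 < u" "0 < v" and irr: "u / v \<notin> \<rat>" and \<delta>: "0 < \<delta>"
  shows "\<forall>\<^sub>F x in at_top. \<exists>m n::nat. \<bar>real m * u + real n * v - x\<bar> < \<delta>"
proof -
  obtain N :: nat where N: "v / \<delta> < real N" using reals_Archimedean2 by blast
  then have "N > 0" using uv \<delta> by (cases N) (auto simp: field_simps zero_less_mult_iff)
  then obtain h k where k: "0 < k" and hk: "\<bar>of_int k * (u / v) - of_int h\<bar> < 1 / N"
    using Dirichlet_approx by metis
  have h: "0 \<le> h"
  proof (rule ccontr)
    assume "\<not> 0 \<le> h"
    then have "real_of_int h \<le> -1" by linarith
    moreover have "0 < of_int k * (u / v)" using k uv by simp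
    moreover have "1 / real N \<le> 1" using \<open>N > 0\<close> by simp
    ultimately show False using hk by linarith
  qed
  define a b where "a = real (nat k) * u" and "b = real (nat h) * v"
  have ab: "a = of_int k * u" "b = of_int h * v" using h k by (auto simp: a_def b_def)
  have "a - b = (of_int k * (u / v) - of_int h) * v" using uv by (simp add: ab field_simps)
  then have "\<bar>a - b\<bar> = \<bar>of_int k * (u / v) - of_int h\<bar> * v" using uv by (simp add: abs_mult)
  also have "\<dots> < 1 / N * v" using hk uv by (intro mult_strict_right_mono) auto
  also have "\<dots> < \<delta>" using N \<delta> \<open>N > 0\<close> by (simp add: field_simps)
  finally have close: "\<bar>a - b\<bar> < \<delta>" .
  have "a \<noteq> b"
  proof
    assume "a = b"
    then have "u / v = of_int h / of_int k" using uv k by (simp add: ab field_simps)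
    then show False using irr by simp
  qed
  then consider "b < a" | "a < b" by linarith
  then show ?thesis
  proof cases
    case 1
    obtain N :: nat and A where A: "\<And>x. A \<le> x \<Longrightarrow>
        \<exists>k\<le>N. \<exists>n::nat. \<bar>real (N - k) * b + real k * a + real n * v - x\<bar> < \<delta>"
      by (rule nonneg_combinations_dense_aux[of b a \<delta> v]) (use 1 close uv in auto)
    show ?thesis
    proof (intro eventually_at_top_linorderI[of A])
      fix x assume "A \<le> x"
      then obtain i n where "\<bar>real (N - i) * b + real i * a + real n * v - x\<bar> < \<delta>" using A by blast
      then have "\<bar>real (i * nat k) * u + real ((N - i) * nat h + n) * v - x\<bar> < \<delta>"
        unfolding a_def b_def of_nat_mult of_nat_add by (simp add: algebra_simps)
      then show "\<exists>m n::nat. \<bar>real m * u + real n * v - x\<bar> < \<delta>" by blast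
    qed
  next
    case 2
    obtain N :: nat and A where A: "\<And>x. A \<le> x \<Longrightarrow>
        \<exists>k\<le>N. \<exists>n::nat. \<bar>real (N - k) * a + real k * b + real n * u - x\<bar> < \<delta>"
      by (rule nonneg_combinations_dense_aux[of a b \<delta> u]) (use 2 close uv in auto)
    show ?thesis
    proof (intro eventually_at_top_linorderI[of A])
      fix x assume "A \<le> x"
      then obtain i n where "\<bar>real (N - i) * a + real i * b + real n * u - x\<bar> < \<delta>" using A by blast
      then have "\<bar>real ((N - i) * nat k + n) * u + real (i * nat h) * v - x\<bar> < \<delta>"
        unfolding a_def b_def of_nat_mult of_nat_add by (simp add: algebra_simps)
      then show "\<exists>m n::nat. \<bar>real m * u + real n * v - x\<bar> < \<delta>" by blast
    qed
  qed
qed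

context markov_renewal
begin

inductive path :: "'s \<Rightarrow> 's \<Rightarrow> real \<Rightarrow> bool" where
  path_refl: "path i i 0"
| path_step: "e \<in> E i \<Longrightarrow> path (tgt e) h s \<Longrightarrow> path i h (len i e + s)"

lemma path_trans: "path i g s \<Longrightarrow> path g h t \<Longrightarrow> path i h (s + t)"
proof (induction rule: path.induct)
  case (path_step e i g s)
  then show ?case using path.path_step[of e i h "s + t"] by (simp add: add.assoc)
qed simp

lemma path_iterate: "path i i u \<Longrightarrow> path i i (real m * u)"
proof (induction m)
  case 0 then show ?case by (simp add: path_refl)
next
  case (Suc m) then show ?case using path_trans[of i i u i "real m * u"] by (simp add: algebra_simps)
qed

lemma path_nonneg: "path i h s \<Longrightarrow> i \<in> S \<Longrightarrow> 0 \<le> s"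
proof (induction rule: path.induct)
  case (path_step e i h s)
  then show ?case using len_ge[of i e] tgt_S[of i e] lmin_pos by simp
qed simp

lemma lmax_pos: "i \<in> S \<Longrightarrow> 0 < lmax"
proof -
  assume i: "i \<in> S"
  then have "E i \<noteq> {}" using p_sum[OF i] by auto
  then obtain e where "e \<in> E i" by blast
  then show ?thesis using len_ge[OF i] len_le[OF i] lmin_pos by fastforce
qed

text \<open>If from some time on \<open>f\<close> is at most \<open>M\<close> and satisfies the homogeneous equation, then later the deficit \<open>M - f\<close> at time \<open>t\<close>
  dominates a fixed proportion \<open>P\<close> of the deficit at the other end of a path of length \<open>s\<close>. The
  proportion must not depend on \<open>f\<close>, \<open>M\<close> or \<open>t\<close>: it is chosen before \<open>f\<close> is taken close to its upper limit.\<close>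

definition transmits :: "'s \<Rightarrow> 's \<Rightarrow> real \<Rightarrow> real \<Rightarrow> bool" where
  "transmits i h s P \<longleftrightarrow> (\<forall>M T f t.
     (\<forall>g\<in>S. \<forall>r\<ge>T. f g r \<le> M) \<longrightarrow> (\<forall>g\<in>S. \<forall>r\<ge>T. f g r = transfer f g r) \<longrightarrow> T + s + lmax \<le> t \<longrightarrow>
     P * (M - f h (t - s)) \<le> M - f i t)"

lemma transmitsD:
  assumes "transmits i h s P" "\<And>g r. g \<in> S \<Longrightarrow> T \<le> r \<Longrightarrow> f g r \<le> M"
    "\<And>g r. g \<in> S \<Longrightarrow> T \<le> r \<Longrightarrow> f g r = transfer f g r" "T + s + lmax \<le> t"
  shows "P * (M - f h (t - s)) \<le> M - f i t"
  using assms unfolding transmits_def by blast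

lemma transmits_antimono:
  assumes "transmits i h s P" "P' \<le> P" "h \<in> S"
  shows "transmits i h s P'"
  unfolding transmits_def
proof (intro allI impI)
  fix M T f t
  assume f: "\<forall>g\<in>S. \<forall>r\<ge>T. f g r \<le> M" "\<forall>g\<in>S. \<forall>r\<ge>T. f g r = transfer f g r" and t: "T + s + lmax \<le> t"
  have "f h (t - s) \<le> M" using f(1) t lmax_pos[OF assms(3)] assms(3) by simp
  then have "P' * (M - f h (t - s)) \<le> P * (M - f h (t - s))"
    using assms by (intro mult_right_mono) auto
  also have "\<dots> \<le> M - f i t" using transmitsD[OF assms(1)] f t by blast
  finally show "P' * (M - f h (t - s)) \<le> M - f i t" .
qed

text \<open>The deficit \<open>M - f\<close> is nonnegative and equals the mean of the earlier deficits, hence it dominates each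
  single term of this mean; \<open>P\<close> is the product of the probabilities along the path.\<close>

lemma path_transmits: "path i h s \<Longrightarrow> i \<in> S \<Longrightarrow> \<exists>P>0. transmits i h s P"
proof (induction rule: path.induct)
  case (path_refl i)
  have "transmits i i 0 1"
    unfolding transmits_def
  proof (intro allI impI)
    fix M t and f :: "'s \<Rightarrow> real \<Rightarrow> real"
    show "1 * (M - f i (t - 0)) \<le> M - f i t" by simp
  qed
  then show ?case by (intro exI[of _ 1]) simp
next
  case (path_step e i h s)
  note i = \<open>i \<in> S\<close> and e = \<open>e \<in> E i\<close>
  have tS: "tgt e \<in> S" using tgt_S[OF i e] .
  obtain P where P: "0 < P" "transmits (tgt e) h s P" using path_step tS by blast
  have s: "0 \<le> s" using path_nonneg[OF path_step.hyps(2) tS] .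
  have "transmits i h (len i e + s) (p i e * P)"
    unfolding transmits_def
  proof (intro allI impI)
    fix M T f t
    assume f: "\<forall>g\<in>S. \<forall>r\<ge>T. f g r \<le> M" "\<forall>g\<in>S. \<forall>r\<ge>T. f g r = transfer f g r"
      and t: "T + (len i e + s) + lmax \<le> t"
    have late: "T \<le> t - len i e'" if "e' \<in> E i" for e'
      using t s len_ge[OF i e] len_le[OF i that] lmin_pos by linarith
    have "T \<le> t" using late[OF e] len_ge[OF i e] lmin_pos by linarith
    then have eq: "f i t = transfer f i t" using f(2) i by blast
    have "P * (M - f h (t - len i e - s)) \<le> M - f (tgt e) (t - len i e)"
    proof (rule transmitsD[OF P(2)])
      show "f g r \<le> M" if "g \<in> S" "T \<le> r" for g r using f(1) that by blast
      show "f g r = transfer f g r" if "g \<in> S" "T \<le> r" for g r using f(2) that by blast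
      show "T + s + lmax \<le> t - len i e" using t by linarith
    qed
    then have "p i e * (P * (M - f h (t - len i e - s))) \<le> p i e * (M - f (tgt e) (t - len i e))"
      using p_pos[OF i e] by (intro mult_left_mono) auto
    then have "p i e * P * (M - f h (t - (len i e + s))) \<le> p i e * (M - f (tgt e) (t - len i e))"
      by (simp add: mult.assoc diff_diff_eq)
    also have "\<dots> \<le> (\<Sum>e\<in>E i. p i e * (M - f (tgt e) (t - len i e)))"
      using p_pos[OF i] f(1) late tgt_S[OF i] e finite_E[OF i]
      by (intro member_le_sum[of e "E i"]) (simp_all add: less_imp_le)
    also have "\<dots> = M - transfer f i t"
      using p_sum[OF i] by (simp add: transfer_apply right_diff_distrib sum_subtractf flip: sum_distrib_right)
    also have "\<dots> = M - f i t" unfolding eq by (rule refl)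
    finally show "p i e * P * (M - f h (t - (len i e + s))) \<le> M - f i t" .
  qed
  then show ?case using P(1) p_pos[OF i e] by (intro exI[of _ "p i e * P"]) simp
qed

text \<open>Left-invariance under the transition matrix, stated by duality with test functions \<open>f\<close>. No sign is
  imposed on \<open>\<pi>\<close>, because it is applied to the real and imaginary parts of a row of a complex matrix.\<close>

definition stationary :: "('s \<Rightarrow> real) \<Rightarrow> bool" where
  "stationary \<pi> \<longleftrightarrow> (\<forall>f. (\<Sum>i\<in>S. \<pi> i * (\<Sum>e\<in>E i. p i e * f (tgt e))) = (\<Sum>i\<in>S. \<pi> i * f i))"

definition mean_len :: "('s \<Rightarrow> real) \<Rightarrow> real" where
  "mean_len \<pi> = (\<Sum>i\<in>S. \<pi> i * (\<Sum>e\<in>E i. p i e * len i e))"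

lemma integral_of_supported:
  fixes f :: "real \<Rightarrow> real"
  assumes "\<And>s. s < c \<or> t < s \<Longrightarrow> f s = 0"
  shows "integral {c..t} f = integral UNIV f"
proof -
  have "integral {c..t} f = integral UNIV (\<lambda>s. if s \<in> {c..t} then f s else 0)"
    by (simp only: integral_restrict_UNIV)
  also have "(\<lambda>s. if s \<in> {c..t} then f s else 0) = f" using assms by fastforce
  finally show ?thesis .
qed

lemma test_fun_continuous:
  assumes "test_fun b K z" "i \<in> S"
  shows "continuous_on A (z i)"
proof (rule lipschitz_on_continuous_on)
  show "K-lipschitz_on A (z i)"
    using assms by (intro lipschitz_onI) (auto simp: test_fun_def dist_real_def)
qed

text \<open>Integrate the renewal equation up to time \<open>t\<close>. With \<open>G\<^sub>i(t)\<close> the integral of \<open>W\<^sub>i\<close> up to \<open>t\<close> it becomes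
  \<open>G\<^sub>i(t) = \<integral>z\<^sub>i + \<Sum> p G(t - len)\<close>, and pairing with \<open>\<pi>\<close> cancels \<open>\<Sum> \<pi>\<^sub>i G\<^sub>i(t)\<close> on both sides.\<close>

lemma conservation:
  assumes z: "test_fun b K z" and \<pi>: "stationary \<pi>" and t: "b \<le> t" "lmax \<le> t"
  shows "(\<Sum>i\<in>S. \<pi> i * (\<Sum>e\<in>E i. p i e * integral {t - len i e..t} (potential z (tgt e))))
    = (\<Sum>i\<in>S. \<pi> i * integral UNIV (z i))"
proof -
  define W where "W = potential z"
  \<comment> \<open>Every shifted copy of \<open>W\<close> vanishes to the left of \<open>-1\<close>; starting at \<open>-2\<close> avoids a discussion of end points.\<close>
  define G where "G i = integral {-2..t} (W i)" for i
  have z0: "\<And>i t. i \<in> S \<Longrightarrow> t < -1 \<Longrightarrow> z i t = 0" using z by (simp add: test_fun_def)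
  have cont: "continuous_on A (W i)" if "i \<in> S" for i A
    unfolding W_def using potential_continuous[OF z that] .
  have W0: "W i s = 0" if "i \<in> S" "s < -1" for i s
    unfolding W_def using potential_vanishes[OF z0 that] .
  have int: "(W i) integrable_on {c..d}" if "i \<in> S" for i c d
    using cont[OF that] by (rule integrable_continuous_interval)
  have b: "0 \<le> b" using z by (simp add: test_fun_def)
  have delayed: "integral {-2..t} (\<lambda>s. W (tgt e) (s - len i e))
      = G (tgt e) - integral {t - len i e..t} (W (tgt e))" if i: "i \<in> S" and e: "e \<in> E i" for i e
  proof -
    have tS: "tgt e \<in> S" and l: "0 < len i e" "len i e \<le> lmax"
      using tgt_S[OF i e] len_ge[OF i e] len_le[OF i e] lmin_pos by auto
    have "integral {-2..t} (\<lambda>s. W (tgt e) (s - len i e)) = integral {-2 - len i e..t - len i e} (W (tgt e))"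
      using integral_shift_real_ivl[of "-2 - len i e" "- len i e" "t - len i e" "W (tgt e)"] by simp
    also have "\<dots> = integral {-2 - len i e..-2} (W (tgt e)) + integral {-2..t - len i e} (W (tgt e))"
      using l t b by (intro Henstock_Kurzweil_Integration.integral_combine[symmetric] int tS) auto
    also have "integral {-2 - len i e..-2} (W (tgt e)) = integral {-2 - len i e..-2} (\<lambda>_. 0)"
      using W0[OF tS] by (intro Henstock_Kurzweil_Integration.integral_cong) auto
    finally have "integral {-2..t} (\<lambda>s. W (tgt e) (s - len i e)) = integral {-2..t - len i e} (W (tgt e))"
      by simp
    moreover have "integral {-2..t - len i e} (W (tgt e)) + integral {t - len i e..t} (W (tgt e)) = G (tgt e)"
      unfolding G_def using l t b
      by (intro Henstock_Kurzweil_Integration.integral_combine int tS) auto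
    ultimately show ?thesis by linarith
  qed
  have G: "G i = integral UNIV (z i)
      + (\<Sum>e\<in>E i. p i e * (G (tgt e) - integral {t - len i e..t} (W (tgt e))))" if i: "i \<in> S" for i
  proof -
    have intW: "(\<lambda>s. W (tgt e) (s - len i e)) integrable_on {-2..t}" if "e \<in> E i" for e
      by (intro integrable_continuous_interval continuous_on_compose2[OF cont[OF tgt_S[OF i that], of UNIV]]
          continuous_intros) auto
    have "G i = integral {-2..t} (\<lambda>s. z i s + (\<Sum>e\<in>E i. p i e * W (tgt e) (s - len i e)))"
      unfolding G_def W_def
      by (rule arg_cong[where f = "integral _"], rule ext)
         (subst renewal_equation[OF z0 i], auto simp: transfer_apply)
    also have "\<dots> = integral {-2..t} (z i) + (\<Sum>e\<in>E i. p i e * integral {-2..t} (\<lambda>s. W (tgt e) (s - len i e)))"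
      using intW finite_E[OF i] test_fun_continuous[OF z i]
      by (simp add: Henstock_Kurzweil_Integration.integral_add Henstock_Kurzweil_Integration.integral_sum
          integrable_continuous_interval integrable_sum integrable_on_mult_right)
    also have "integral {-2..t} (z i) = integral UNIV (z i)"
      using z i t by (intro integral_of_supported) (auto simp: test_fun_def)
    also have "(\<Sum>e\<in>E i. p i e * integral {-2..t} (\<lambda>s. W (tgt e) (s - len i e)))
        = (\<Sum>e\<in>E i. p i e * (G (tgt e) - integral {t - len i e..t} (W (tgt e))))"
      by (intro sum.cong refl) (simp add: delayed[OF i])
    finally show ?thesis .
  qed
  have "(\<Sum>i\<in>S. \<pi> i * G i) = (\<Sum>i\<in>S. \<pi> i * integral UNIV (z i)) + (\<Sum>i\<in>S. \<pi> i * (\<Sum>e\<in>E i. p i e * G (tgt e)))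
      - (\<Sum>i\<in>S. \<pi> i * (\<Sum>e\<in>E i. p i e * integral {t - len i e..t} (W (tgt e))))"
    unfolding sum.distrib[symmetric] sum_subtractf[symmetric]
  proof (rule sum.cong[OF refl])
    fix i assume i: "i \<in> S"
    show "\<pi> i * G i = \<pi> i * integral UNIV (z i) + \<pi> i * (\<Sum>e\<in>E i. p i e * G (tgt e))
        - \<pi> i * (\<Sum>e\<in>E i. p i e * integral {t - len i e..t} (W (tgt e)))"
      by (subst G[OF i]) (simp add: right_diff_distrib distrib_left sum_subtractf)
  qed
  moreover have "(\<Sum>i\<in>S. \<pi> i * (\<Sum>e\<in>E i. p i e * G (tgt e))) = (\<Sum>i\<in>S. \<pi> i * G i)"
    using \<pi> unfolding stationary_def by blast
  ultimately show ?thesis by (simp add: W_def)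
qed

text \<open>A common upper limit over all states. It is the infimum of the numbers that eventually bound every
  component.\<close>

lemma exists_limsup:
  fixes f :: "'s \<Rightarrow> real \<Rightarrow> real"
  assumes "S \<noteq> {}" and "\<And>i t. i \<in> S \<Longrightarrow> \<bar>f i t\<bar> \<le> (C::real)"
  shows "\<exists>M. (\<forall>\<eta>>0. \<exists>T. \<forall>t\<ge>T. \<forall>i\<in>S. f i t \<le> M + \<eta>) \<and> (\<forall>\<eta>>0. \<forall>T. \<exists>t\<ge>T. \<exists>i\<in>S. M - \<eta> < f i t)"
proof -
  define X where "X = {x. \<exists>T. \<forall>t\<ge>T. \<forall>i\<in>S. f i t \<le> x}"
  obtain i0 where i0: "i0 \<in> S" using assms(1) by blast
  have "C \<in> X" using assms(2) by (auto simp: X_def abs_le_iff)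
  then have ne: "X \<noteq> {}" by blast
  have lb: "- C \<le> x" if "x \<in> X" for x
  proof -
    obtain T where "\<forall>t\<ge>T. \<forall>i\<in>S. f i t \<le> x" using \<open>x \<in> X\<close> by (auto simp: X_def)
    then have "f i0 T \<le> x" using i0 by auto
    moreover have "- C \<le> f i0 T" using assms(2)[OF i0, of T] by linarith
    ultimately show ?thesis by linarith
  qed
  then have bdd: "bdd_below X" by (meson bdd_below.I)
  show ?thesis
  proof (rule exI[of _ "Inf X"], intro conjI allI impI)
    fix \<eta> :: real assume "0 < \<eta>"
    then obtain x where "x \<in> X" "x < Inf X + \<eta>" using cInf_less_iff[OF ne bdd, of "Inf X + \<eta>"] by auto
    then show "\<exists>T. \<forall>t\<ge>T. \<forall>i\<in>S. f i t \<le> Inf X + \<eta>" by (fastforce simp: X_def)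
  next
    fix \<eta> T :: real assume "0 < \<eta>"
    then have "Inf X - \<eta> \<notin> X" using cInf_lower[OF _ bdd] by force
    then show "\<exists>t\<ge>T. \<exists>i\<in>S. Inf X - \<eta> < f i t" by (auto simp: X_def not_le)
  qed
qed

end

section \<open>The key renewal theorem\<close>

text \<open>The function that rises from \<open>0\<close> at \<open>lo\<close> to \<open>1\<close> with slope \<open>1 / \<epsilon>\<close> and returns to \<open>0\<close> at \<open>hi\<close>; for
  \<open>hi - lo < 2 * \<epsilon>\<close> it is a triangle of height less than one, and for \<open>hi \<le> lo\<close> it is zero.\<close>

definition trapezoid :: "real \<Rightarrow> real \<Rightarrow> real \<Rightarrow> real \<Rightarrow> real" where
  "trapezoid lo hi \<epsilon> t = max 0 (min 1 (min ((t - lo) / \<epsilon>) ((hi - t) / \<epsilon>)))"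

lemma trapezoid_nonneg: "0 \<le> trapezoid lo hi \<epsilon> t"
  and trapezoid_le_1: "trapezoid lo hi \<epsilon> t \<le> 1"
  by (simp_all add: trapezoid_def)

lemma trapezoid_outside:
  assumes "0 < \<epsilon>" "t \<le> lo \<or> hi \<le> t"
  shows "trapezoid lo hi \<epsilon> t = 0"
proof -
  have "(t - lo) / \<epsilon> \<le> 0 \<or> (hi - t) / \<epsilon> \<le> 0" using assms by (auto simp: divide_le_0_iff)
  then show ?thesis by (auto simp: trapezoid_def)
qed

lemma trapezoid_inside: "0 < \<epsilon> \<Longrightarrow> lo + \<epsilon> \<le> t \<Longrightarrow> t \<le> hi - \<epsilon> \<Longrightarrow> trapezoid lo hi \<epsilon> t = 1"
  by (auto simp: trapezoid_def max_def min_def field_simps)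

lemma trapezoid_lipschitz:
  assumes "0 < \<epsilon>"
  shows "\<bar>trapezoid lo hi \<epsilon> s - trapezoid lo hi \<epsilon> t\<bar> \<le> \<bar>s - t\<bar> / \<epsilon>"
proof -
  have "(s - lo) / \<epsilon> - (t - lo) / \<epsilon> = (s - t) / \<epsilon>" "(hi - s) / \<epsilon> - (hi - t) / \<epsilon> = - ((s - t) / \<epsilon>)"
    by (simp_all add: diff_divide_distrib)
  moreover have "\<bar>s - t\<bar> / \<epsilon> = \<bar>(s - t) / \<epsilon>\<bar>" using assms by simp
  moreover have "\<bar>max 0 (min 1 (min x y)) - max 0 (min 1 (min x' y'))\<bar> \<le> \<bar>d\<bar>"
    if "x - x' = d" "y - y' = - d" for x y x' y' d :: real
    using that unfolding max_def min_def abs_if by (simp split: if_splits; linarith)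
  ultimately show ?thesis unfolding trapezoid_def by metis
qed

lemma trapezoid_continuous: "0 < \<epsilon> \<Longrightarrow> continuous_on A (trapezoid lo hi \<epsilon>)"
  unfolding trapezoid_def by (intro continuous_intros) auto

lemma integral_trapezoid:
  assumes \<epsilon>: "0 < \<epsilon>" and "lo \<le> hi"
  shows "hi - lo - 2 * \<epsilon> \<le> integral UNIV (trapezoid lo hi \<epsilon>)"
    and "integral UNIV (trapezoid lo hi \<epsilon>) \<le> hi - lo"
proof -
  let ?f = "trapezoid lo hi \<epsilon>"
  have int: "?f integrable_on {c..d}" for c d
    by (intro integrable_continuous_interval trapezoid_continuous \<epsilon>)
  have "integral UNIV ?f = integral UNIV (\<lambda>t. if t \<in> {lo..hi} then ?f t else 0)"
    using trapezoid_outside[OF \<epsilon>] by (intro arg_cong[where f = "integral UNIV"]) (auto simp: fun_eq_iff)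
  also have "\<dots> = integral {lo..hi} ?f" by (simp only: integral_restrict_UNIV)
  finally have eq: "integral UNIV ?f = integral {lo..hi} ?f" .
  have "integral {lo..hi} ?f \<le> integral {lo..hi} (\<lambda>_. 1)"
    by (intro integral_le int) (auto simp: trapezoid_le_1)
  then show "integral UNIV ?f \<le> hi - lo" using assms(2) eq by simp
  show "hi - lo - 2 * \<epsilon> \<le> integral UNIV ?f"
  proof (cases "lo + \<epsilon> \<le> hi - \<epsilon>")
    case True
    have "integral {lo + \<epsilon>..hi - \<epsilon>} (\<lambda>_. 1) = integral {lo + \<epsilon>..hi - \<epsilon>} ?f"
      using trapezoid_inside[OF \<epsilon>] by (intro Henstock_Kurzweil_Integration.integral_cong) auto
    also have "\<dots> \<le> integral {lo..hi} ?f"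
      using \<epsilon> by (intro integral_subset_le int) (auto simp: trapezoid_nonneg)
    finally show ?thesis using eq True by simp
  next
    case False
    moreover have "0 \<le> integral {lo..hi} ?f"
      by (intro integral_nonneg int) (auto simp: trapezoid_nonneg)
    ultimately show ?thesis using eq by linarith
  qed
qed

lemma trapezoid_integrable:
  assumes "0 < \<epsilon>"
  shows "trapezoid lo hi \<epsilon> integrable_on UNIV"
proof -
  have "(\<lambda>t. if t \<in> {lo..hi} then trapezoid lo hi \<epsilon> t else 0) = trapezoid lo hi \<epsilon>"
    using trapezoid_outside[OF assms] by (auto simp: fun_eq_iff)
  then show ?thesis
    using integrable_continuous_interval[OF trapezoid_continuous[OF assms], of lo hi lo hi]
      integrable_restrict_UNIV[of "{lo..hi}" "trapezoid lo hi \<epsilon>"] by simp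
qed

locale nonarithmetic_renewal = markov_renewal +
  assumes connected: "i \<in> S \<Longrightarrow> h \<in> S \<Longrightarrow> \<exists>s. path i h s"
    and incommensurable_loops:
      "\<exists>g\<in>S. \<exists>g'\<in>S. \<exists>u>0. \<exists>v>0. u / v \<notin> \<rat> \<and> path g g u \<and> path g' g' v"
begin

lemma S_nonempty: "S \<noteq> {}"
  using incommensurable_loops by blast

text \<open>Route the path through both incommensurable loops and run through them as often as
  needed: its length is a fixed number plus a nonnegative integer combination of the two loop lengths.\<close>

lemma path_lengths_dense:
  assumes \<delta>: "0 < \<delta>"
  shows "\<forall>\<^sub>F x in at_top. \<forall>i\<in>S. \<forall>h\<in>S. \<exists>s. path i h s \<and> \<bar>s - x\<bar> < \<delta>"
proof (intro eventually_ball_finite finite_S ballI)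
  fix i h assume i: "i \<in> S" and h: "h \<in> S"
  obtain g g' u v where g: "g \<in> S" "g' \<in> S" and uv: "0 < u" "0 < v" "u / v \<notin> \<rat>"
    and loops: "path g g u" "path g' g' v" using incommensurable_loops by blast
  obtain a b c where abc: "path i g a" "path g g' b" "path g' h c"
    using connected i h g by meson
  obtain A where A: "\<And>x. A \<le> x \<Longrightarrow> \<exists>m n::nat. \<bar>real m * u + real n * v - x\<bar> < \<delta>"
    using nonneg_combinations_dense[OF uv \<delta>] by (auto simp: eventually_at_top_linorder)
  show "\<forall>\<^sub>F x in at_top. \<exists>s. path i h s \<and> \<bar>s - x\<bar> < \<delta>"
  proof (rule eventually_at_top_linorderI[of "A + (a + b + c)"])
    fix x assume "A + (a + b + c) \<le> x"
    then obtain m n where mn: "\<bar>real m * u + real n * v - (x - (a + b + c))\<bar> < \<delta>"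
      using A[of "x - (a + b + c)"] by auto
    have "path i h (a + (real m * u + (b + (real n * v + c))))"
      using abc loops by (meson path_iterate path_trans)
    moreover have "\<bar>a + (real m * u + (b + (real n * v + c))) - x\<bar> < \<delta>" using mn by linarith
    ultimately show "\<exists>s. path i h s \<and> \<bar>s - x\<bar> < \<delta>" by blast
  qed
qed

text \<open>For a given accuracy only finitely many paths are involved, so one proportion \<open>P\<close> serves them all.\<close>

lemma uniform_transmission:
  assumes \<delta>: "0 < \<delta>"
  shows "\<exists>A\<ge>0. \<exists>P>0. P \<le> 1 \<and> (\<forall>i\<in>S. \<forall>h\<in>S. \<forall>x\<in>{A..A + lmax}. \<exists>s. \<bar>s - x\<bar> < \<delta> \<and> transmits i h s P)"
proof -
  define \<rho> where "\<rho> = \<delta> / 2"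
  have \<rho>: "0 < \<rho>" using \<delta> by (simp add: \<rho>_def)
  obtain A0 where A0: "\<And>x. A0 \<le> x \<Longrightarrow> \<forall>i\<in>S. \<forall>h\<in>S. \<exists>s. path i h s \<and> \<bar>s - x\<bar> < \<rho>"
    using path_lengths_dense[OF \<rho>] by (auto simp: eventually_at_top_linorder)
  define A where "A = max 0 A0"
  obtain N :: nat where "lmax / \<rho> < real N" using reals_Archimedean2 by blast
  then have N: "lmax < real N * \<rho>" using \<rho> by (simp add: field_simps)
  have "\<forall>\<^sub>F P in at_right 0. \<forall>i\<in>S. \<forall>h\<in>S. \<forall>k\<in>{..N}.
      \<exists>s. \<bar>s - (A + real k * \<rho>)\<bar> < \<rho> \<and> transmits i h s P"
  proof (intro eventually_ball_finite finite_S finite_atMost ballI)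
    fix i h k assume i: "i \<in> S" and h: "h \<in> S"
    have "A0 \<le> A + real k * \<rho>" using \<rho> by (simp add: A_def add_increasing2)
    then obtain s where s: "path i h s" "\<bar>s - (A + real k * \<rho>)\<bar> < \<rho>"
      using A0 i h by blast
    obtain P where P: "0 < P" "transmits i h s P" using path_transmits[OF s(1) i] by blast
    have "\<forall>\<^sub>F P' in at_right 0. P' < P" using P(1) by (auto simp: eventually_at_right)
    then show "\<forall>\<^sub>F P' in at_right 0. \<exists>s. \<bar>s - (A + real k * \<rho>)\<bar> < \<rho> \<and> transmits i h s P'"
      by eventually_elim (use s P transmits_antimono[OF P(2) _ h] in \<open>meson less_imp_le\<close>)
  qed
  then obtain B where B: "0 < B" "\<And>P i h k. 0 < P \<Longrightarrow> P < B \<Longrightarrow> i \<in> S \<Longrightarrow> h \<in> S \<Longrightarrow> k \<in> {..N} \<Longrightarrow>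
      \<exists>s. \<bar>s - (A + real k * \<rho>)\<bar> < \<rho> \<and> transmits i h s P"
    unfolding eventually_at_right_field by blast
  define P where "P = min 1 (B / 2)"
  have P: "0 < P" "P < B" "P \<le> 1" using B(1) by (auto simp: P_def)
  have "\<exists>s. \<bar>s - x\<bar> < \<delta> \<and> transmits i h s P"
    if i: "i \<in> S" and h: "h \<in> S" and x: "x \<in> {A..A + lmax}" for i h x
  proof -
    define k where "k = nat \<lfloor>(x - A) / \<rho>\<rfloor>"
    have "0 \<le> (x - A) / \<rho>" using x \<rho> by simp
    then have "real k \<le> (x - A) / \<rho>" "(x - A) / \<rho> < real k + 1" unfolding k_def by linarith+
    then have k: "real k * \<rho> \<le> x - A" "x - A < real k * \<rho> + \<rho>" using \<rho> by (auto simp: field_simps)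
    moreover have "x - A \<le> lmax" using x by simp
    ultimately have "real k * \<rho> < real N * \<rho>" using N by linarith
    then have "k \<in> {..N}" using \<rho> by simp
    then obtain s where s: "\<bar>s - (A + real k * \<rho>)\<bar> < \<rho>" "transmits i h s P"
      using B(2) P i h by blast
    have "\<bar>s - x\<bar> < \<delta>" using s(1) k \<rho>_def by linarith
    then show ?thesis using s(2) by blast
  qed
  moreover have "0 \<le> A" by (simp add: A_def)
  ultimately show ?thesis using P by blast
qed

text \<open>Take a late time \<open>t\<close> at which some component exceeds \<open>M - \<eta>\<close>. Along paths the deficit is multiplied by at
  most \<open>1 / P\<close>, so all components are close to \<open>M\<close> at times that are \<open>\<rho>\<close>-dense in a window of length
  \<open>lmax\<close> before \<open>t - A\<close>, and Lipschitz continuity fills the gaps.\<close>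

lemma near_limsup_on_window:
  assumes z: "test_fun b K z" and \<delta>: "0 < \<delta>"
    and above: "\<forall>\<eta>>0. \<exists>T. \<forall>t\<ge>T. \<forall>i\<in>S. potential z i t \<le> M + \<eta>"
    and often: "\<forall>\<eta>>0. \<forall>T. \<exists>t\<ge>T. \<exists>i\<in>S. M - \<eta> < potential z i t"
  shows "\<exists>t\<ge>T. \<forall>h\<in>S. \<forall>u\<in>{t - lmax..t}. \<bar>potential z h u - M\<bar> \<le> \<delta>"
proof -
  obtain K' where K': "K' \<ge> 0" and lip: "\<And>i s t. i \<in> S \<Longrightarrow> \<bar>s - t\<bar> \<le> 1 \<Longrightarrow>
      \<bar>potential z i s - potential z i t\<bar> \<le> K' * \<bar>s - t\<bar>"
    using potential_lipschitz[OF z] by blast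
  \<comment> \<open>Over a distance \<open>\<rho>\<close> the solution varies by at most \<open>\<delta> / 2\<close>; the Lipschitz bound needs distances up to \<open>1\<close>.\<close>
  define \<rho> where "\<rho> = min 1 (\<delta> / (2 * (K' + 1)))"
  have \<rho>: "0 < \<rho>" "\<rho> \<le> 1" using K' \<delta> by (auto simp: \<rho>_def)
  have "K' * \<rho> \<le> K' * (\<delta> / (2 * (K' + 1)))" using K' by (intro mult_left_mono) (simp_all add: \<rho>_def)
  also have "\<dots> \<le> \<delta> / 2" using K' \<delta> by (simp add: field_simps)
  finally have K\<rho>: "K' * \<rho> \<le> \<delta> / 2" .
  obtain A P where A: "0 \<le> A" and P: "0 < P" "P \<le> 1"
    and AP: "\<And>i h x. i \<in> S \<Longrightarrow> h \<in> S \<Longrightarrow> x \<in> {A..A + lmax} \<Longrightarrow> \<exists>s. \<bar>s - x\<bar> < \<rho> \<and> transmits i h s P"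
    using uniform_transmission[OF \<rho>(1)] by blast
  \<comment> \<open>The deficit from \<open>M + \<eta>\<close> is below \<open>2 * \<eta>\<close> at the chosen time, hence below \<open>2 * \<eta> / P = \<delta> / 2\<close> along paths.\<close>
  define \<eta> where "\<eta> = P * \<delta> / 4"
  have \<eta>: "0 < \<eta>" "\<eta> \<le> \<delta>" using P \<delta> mult_right_mono[of P 1 \<delta>] by (auto simp: \<eta>_def)
  obtain T1 where T1: "\<forall>t\<ge>T1. \<forall>i\<in>S. potential z i t \<le> M + \<eta>" using above \<eta>(1) by blast
  define T2 where "T2 = max T1 (b + 1)"
  obtain t i where t: "max T T2 + A + 2 * lmax + 2 \<le> t" and i: "i \<in> S" and ti: "M - \<eta> < potential z i t"
    using often \<eta>(1) by meson
  have lm: "0 < lmax" using lmax_pos[OF i] .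
  have "\<bar>potential z h u - M\<bar> \<le> \<delta>" if h: "h \<in> S" and u: "u \<in> {t - A - lmax..t - A}" for h u
  proof -
    have "t - u \<in> {A..A + lmax}" using u by auto
    then obtain s where s: "\<bar>s - (t - u)\<bar> < \<rho>" "transmits i h s P" using AP i h by blast
    have le: "potential z g r \<le> M + \<eta>" if "g \<in> S" "T2 \<le> r" for g r
      using T1 that by (simp add: T2_def)
    have "P * (M + \<eta> - potential z h (t - s)) \<le> M + \<eta> - potential z i t"
    proof (rule transmitsD[OF s(2), where T = T2])
      show "potential z g r = transfer (potential z) g r" if "g \<in> S" "T2 \<le> r" for g r
        using homogeneous_after_support[OF z] that by (simp add: T2_def)
      have "t - u \<le> A + lmax" "T2 \<le> max T T2" using u by auto
      then show "T2 + s + lmax \<le> t" using t s(1) \<rho> by linarith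
    qed (rule le)
    also have "\<dots> \<le> 2 * \<eta>" using ti by simp
    also have "2 * \<eta> = P * (\<delta> / 2)" by (simp add: \<eta>_def)
    finally have "M + \<eta> - potential z h (t - s) \<le> \<delta> / 2"
      using P(1) by (simp only: mult_le_cancel_left_pos)
    moreover have "\<bar>potential z h (t - s) - potential z h u\<bar> \<le> K' * \<bar>t - s - u\<bar>"
      using s(1) \<rho> by (intro lip h) auto
    moreover have "K' * \<bar>t - s - u\<bar> \<le> K' * \<rho>" using s(1) K' by (intro mult_left_mono) auto
    moreover have "potential z h u \<le> M + \<eta>" using t u lm by (intro le h) auto
    ultimately show ?thesis using K\<rho> \<eta> by linarith
  qed
  moreover have "T \<le> t - A" using t lm by simp
  ultimately show ?thesis by blast
qed

text \<open>On a window where all components are within \<open>\<delta>\<close> of \<open>M\<close>, the conserved quantity is within a multiple of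
  \<open>\<delta>\<close> of \<open>M * mean_len \<pi>\<close>. The value of the conserved quantity does not depend on \<open>\<delta>\<close>.\<close>

lemma limsup_determined_by_mass:
  assumes z: "test_fun b K z"
  shows "\<exists>M. (\<forall>\<eta>>0. \<exists>T. \<forall>t\<ge>T. \<forall>i\<in>S. potential z i t \<le> M + \<eta>) \<and>
    (\<forall>\<pi>. stationary \<pi> \<longrightarrow> M * mean_len \<pi> = (\<Sum>i\<in>S. \<pi> i * integral UNIV (z i)))"
proof -
  obtain C where C: "\<forall>i\<in>S. \<forall>t. \<bar>potential z i t\<bar> \<le> C" using potential_bounded[OF z] by blast
  obtain M where above: "\<forall>\<eta>>0. \<exists>T. \<forall>t\<ge>T. \<forall>i\<in>S. potential z i t \<le> M + \<eta>"
    and often: "\<forall>\<eta>>0. \<forall>T. \<exists>t\<ge>T. \<exists>i\<in>S. M - \<eta> < potential z i t"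
    using exists_limsup[of "potential z" C] S_nonempty C by blast
  have "M * mean_len \<pi> = (\<Sum>i\<in>S. \<pi> i * integral UNIV (z i))" if \<pi>: "stationary \<pi>" for \<pi>
  proof -
    define m where "m i = (\<Sum>e\<in>E i. p i e * len i e)" for i
    define D where "D = \<bar>(\<Sum>i\<in>S. \<pi> i * integral UNIV (z i)) - M * mean_len \<pi>\<bar>"
    have bound: "D \<le> \<delta> * (\<Sum>i\<in>S. \<bar>\<pi> i\<bar> * m i)" if \<delta>: "0 < \<delta>" for \<delta>
    proof -
      obtain t where t: "max b lmax \<le> t"
        and near: "\<forall>h\<in>S. \<forall>u\<in>{t - lmax..t}. \<bar>potential z h u - M\<bar> \<le> \<delta>"
        using near_limsup_on_window[OF z \<delta> above often] by blast
      define J where "J i e = integral {t - len i e..t} (potential z (tgt e))" for i e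
      have J: "\<bar>J i e - M * len i e\<bar> \<le> \<delta> * len i e" if i: "i \<in> S" and e: "e \<in> E i" for i e
      proof -
        have l: "0 < len i e" "len i e \<le> lmax" using len_ge[OF i e] len_le[OF i e] lmin_pos by auto
        have int: "potential z (tgt e) integrable_on {t - len i e..t}"
          by (intro integrable_continuous_interval potential_continuous[OF z] tgt_S[OF i e])
        have "J i e - M * len i e = integral {t - len i e..t} (\<lambda>u. potential z (tgt e) u - M)"
          unfolding J_def using l int by (subst Henstock_Kurzweil_Integration.integral_diff) auto
        also have "norm \<dots> \<le> \<delta> * (t - (t - len i e))"
        proof (rule integral_bound)
          show "continuous_on {t - len i e..t} (\<lambda>u. potential z (tgt e) u - M)"
            by (intro continuous_intros potential_continuous[OF z] tgt_S[OF i e])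
          show "\<And>u. u \<in> {t - len i e..t} \<Longrightarrow> norm (potential z (tgt e) u - M) \<le> \<delta>"
            using near tgt_S[OF i e] l by simp
        qed (use l in auto)
        finally show ?thesis by simp
      qed
      have "(\<Sum>i\<in>S. \<pi> i * integral UNIV (z i)) - M * mean_len \<pi>
          = (\<Sum>i\<in>S. \<pi> i * (\<Sum>e\<in>E i. p i e * (J i e - M * len i e)))"
        using conservation[OF z \<pi>, of t] t
        by (simp add: mean_len_def J_def right_diff_distrib sum_subtractf sum_distrib_left mult_ac)
      then have "D \<le> (\<Sum>i\<in>S. \<bar>\<pi> i * (\<Sum>e\<in>E i. p i e * (J i e - M * len i e))\<bar>)"
        unfolding D_def by (simp add: sum_abs)
      also have "\<dots> \<le> (\<Sum>i\<in>S. \<bar>\<pi> i\<bar> * (\<delta> * m i))"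
      proof (rule sum_mono)
        fix i assume i: "i \<in> S"
        have "\<bar>\<Sum>e\<in>E i. p i e * (J i e - M * len i e)\<bar> \<le> (\<Sum>e\<in>E i. \<bar>p i e * (J i e - M * len i e)\<bar>)"
          by (rule sum_abs)
        also have "\<dots> \<le> (\<Sum>e\<in>E i. p i e * (\<delta> * len i e))"
          using J[OF i] p_pos[OF i] by (intro sum_mono) (simp add: abs_mult less_imp_le mult_left_mono)
        also have "\<dots> = \<delta> * m i" by (simp add: m_def sum_distrib_left mult_ac)
        finally show "\<bar>\<pi> i * (\<Sum>e\<in>E i. p i e * (J i e - M * len i e))\<bar> \<le> \<bar>\<pi> i\<bar> * (\<delta> * m i)"
          by (simp add: abs_mult mult_left_mono)
      qed
      also have "\<dots> = \<delta> * (\<Sum>i\<in>S. \<bar>\<pi> i\<bar> * m i)" by (simp add: sum_distrib_left mult_ac)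
      finally show ?thesis .
    qed
    \<comment> \<open>The bound holds for every positive \<open>\<delta>\<close>.\<close>
    have "D \<le> 0"
    proof (rule tendsto_lowerbound)
      show "((\<lambda>\<delta>. \<delta> * (\<Sum>i\<in>S. \<bar>\<pi> i\<bar> * m i)) \<longlongrightarrow> 0) (at_right 0)"
        by (intro tendsto_mult_left_zero tendsto_ident_at)
      show "\<forall>\<^sub>F \<delta> in at_right 0. D \<le> \<delta> * (\<Sum>i\<in>S. \<bar>\<pi> i\<bar> * m i)"
        using bound by (auto simp: eventually_at_right_field intro: exI[of _ 1])
    qed simp
    then show ?thesis by (simp add: D_def)
  qed
  then show ?thesis using above by blast
qed

text \<open>A source concentrated in one state detects the corresponding entry of an invariant vector.\<close>

lemma mass_of_bump:
  assumes "h \<in> S"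
  shows "\<exists>z b K I. test_fun b K z \<and> 0 < I \<and> (\<forall>a. (\<Sum>i\<in>S. a i * integral UNIV (z i)) = a h * I)"
proof -
  define z where "z i = (if i = h then trapezoid 0 1 (1 / 4) else (\<lambda>_. 0))" for i
  define I where "I = integral UNIV (trapezoid 0 1 (1 / 4))"
  have "test_fun 1 4 z"
    using trapezoid_lipschitz[of "1/4" 0 1]
    by (auto simp: test_fun_def z_def trapezoid_outside mult.commute)
  moreover have "0 < I" using integral_trapezoid(1)[of "1/4" 0 1] by (simp add: I_def)
  moreover have "(\<Sum>i\<in>S. a i * integral UNIV (z i)) = a h * I" for a
  proof -
    have "(\<Sum>i\<in>S. a i * integral UNIV (z i)) = (\<Sum>i\<in>S. if i = h then a h * I else 0)"
      by (intro sum.cong) (auto simp: z_def I_def)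
    then show ?thesis using assms finite_S by simp
  qed
  ultimately show ?thesis by blast
qed

definition complex_mean_len :: "('a \<Rightarrow> complex) \<Rightarrow> complex" where
  "complex_mean_len a = (\<Sum>i\<in>S. a i * of_real (\<Sum>e\<in>E i. p i e * len i e))"

context
  fixes a :: "'a \<Rightarrow> complex"
  assumes Re_stationary: "stationary (\<lambda>i. Re (a i))" and Im_stationary: "stationary (\<lambda>i. Im (a i))"
    and nonzero: "\<exists>h\<in>S. a h \<noteq> 0"
begin

lemma complex_mean_len_parts:
  "Re (complex_mean_len a) = mean_len (\<lambda>i. Re (a i))" "Im (complex_mean_len a) = mean_len (\<lambda>i. Im (a i))"
  by (simp_all add: complex_mean_len_def mean_len_def)

text \<open>If the mean length vanished, then by \<open>limsup_determined_by_mass\<close> every source would have mass zero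
  against \<open>a\<close>, in particular a bump at a state where \<open>a\<close> is nonzero. This
  avoids a Perron-Frobenius argument for the sign of \<open>a\<close>.\<close>

lemma complex_mean_len_nonzero: "complex_mean_len a \<noteq> 0"
proof
  assume 0: "complex_mean_len a = 0"
  obtain h where h: "h \<in> S" "a h \<noteq> 0" using nonzero by blast
  obtain z b K I where z: "test_fun b K z" and I: "0 < (I::real)"
    "\<And>a. (\<Sum>i\<in>S. a i * integral UNIV (z i)) = a h * I" using mass_of_bump[OF h(1)] by blast
  obtain M where M_mass: "\<And>\<pi>. stationary \<pi> \<Longrightarrow> M * mean_len \<pi> = (\<Sum>i\<in>S. \<pi> i * integral UNIV (z i))"
    using limsup_determined_by_mass[OF z] by blast
  have M: "M * mean_len \<pi> = \<pi> h * I" if "stationary \<pi>" for \<pi>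
    using M_mass[OF that] I(2)[of \<pi>] by simp
  have "Re (a h) * I = 0" "Im (a h) * I = 0"
    using M[OF Re_stationary] M[OF Im_stationary]
    by (simp_all only: complex_mean_len_parts[symmetric] 0 complex.sel zero_complex.sel mult_zero_right)
  then show False using I(1) h(2) by (simp add: complex_eq_iff)
qed

lemma limsup_quotient:
  assumes M: "\<And>\<pi>. stationary \<pi> \<Longrightarrow> M * mean_len \<pi> = (\<Sum>i\<in>S. \<pi> i * x i)"
  shows "of_real M = (\<Sum>i\<in>S. (a i / complex_mean_len a) * of_real (x i))"
proof -
  have "of_real M * complex_mean_len a = (\<Sum>i\<in>S. a i * of_real (x i))"
    using M[OF Re_stationary] M[OF Im_stationary]
    by (simp add: complex_eq_iff complex_mean_len_parts)
  then have "of_real M = (\<Sum>i\<in>S. a i * of_real (x i)) / complex_mean_len a"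
    using complex_mean_len_nonzero by (simp add: field_simps)
  then show ?thesis by (simp add: sum_divide_distrib)
qed

text \<open>The upper limit of the solution for a bump at \<open>h\<close> is a real number and a positive multiple of the
  quotient.\<close>

lemma normalized_real:
  assumes h: "h \<in> S"
  shows "a h / complex_mean_len a = of_real (Re (a h / complex_mean_len a))"
proof -
  obtain z b K I where z: "test_fun b K z" and I: "0 < (I::real)"
    "\<And>a. (\<Sum>i\<in>S. a i * integral UNIV (z i)) = a h * I" using mass_of_bump[OF h] by blast
  obtain M where M_mass: "\<And>\<pi>. stationary \<pi> \<Longrightarrow> M * mean_len \<pi> = (\<Sum>i\<in>S. \<pi> i * integral UNIV (z i))"
    using limsup_determined_by_mass[OF z] by blast
  have M: "M * mean_len \<pi> = \<pi> h * I" if "stationary \<pi>" for \<pi>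
    using M_mass[OF that] I(2)[of \<pi>] by simp
  have "M * mean_len \<pi> = (\<Sum>i\<in>S. \<pi> i * (if i = h then I else 0))" if "stationary \<pi>" for \<pi>
  proof -
    have "(\<Sum>i\<in>S. \<pi> i * (if i = h then I else 0)) = (\<Sum>i\<in>S. if i = h then \<pi> h * I else 0)"
      by (intro sum.cong) auto
    then show ?thesis using M[OF that] h finite_S by simp
  qed
  then have "of_real M = (\<Sum>i\<in>S. (a i / complex_mean_len a) * of_real (if i = h then I else 0))"
    by (rule limsup_quotient)
  also have "\<dots> = (\<Sum>i\<in>S. if i = h then a h / complex_mean_len a * of_real I else 0)"
    by (intro sum.cong) auto
  finally have "of_real M = a h / complex_mean_len a * of_real I" using h finite_S by simp
  then have "a h / complex_mean_len a = of_real (M / I)" using I(1) by (simp add: field_simps)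
  then show ?thesis by (metis Re_complex_of_real)
qed

text \<open>The upper limits for \<open>z\<close> and for \<open>- z\<close> are computed by the same linear functional of the source, so
  the upper limit of the solution equals its lower limit.\<close>

lemma key_renewal:
  assumes z: "test_fun b K z" and i: "i \<in> S"
  shows "(potential z i \<longlongrightarrow> (\<Sum>h\<in>S. Re (a h / complex_mean_len a) * integral UNIV (z h))) at_top"
proof -
  define L where "L x = (\<Sum>h\<in>S. Re (a h / complex_mean_len a) * x h)" for x
  have L: "M = L x" if "\<And>\<pi>. stationary \<pi> \<Longrightarrow> M * mean_len \<pi> = (\<Sum>i\<in>S. \<pi> i * x i)" for M x
  proof -
    have "of_real M = (\<Sum>i\<in>S. (a i / complex_mean_len a) * of_real (x i))" using that by (rule limsup_quotient)
    also have "\<dots> = (\<Sum>i\<in>S. of_real (Re (a i / complex_mean_len a) * x i))"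
      by (intro sum.cong refl, subst normalized_real) auto
    also have "\<dots> = of_real (L x)" by (simp add: L_def)
    finally show ?thesis by simp
  qed
  obtain M where M: "\<And>\<eta>. 0 < \<eta> \<Longrightarrow> \<exists>T. \<forall>t\<ge>T. \<forall>i\<in>S. potential z i t \<le> M + \<eta>"
    and M_eq: "\<And>\<pi>. stationary \<pi> \<Longrightarrow> M * mean_len \<pi> = (\<Sum>i\<in>S. \<pi> i * integral UNIV (z i))"
    using limsup_determined_by_mass[OF z] by blast
  obtain M' where M'': "\<And>\<eta>. 0 < \<eta> \<Longrightarrow> \<exists>T. \<forall>t\<ge>T. \<forall>i\<in>S. potential (\<lambda>i t. - z i t) i t \<le> M' + \<eta>"
    and M'_eq: "\<And>\<pi>. stationary \<pi> \<Longrightarrow> M' * mean_len \<pi> = (\<Sum>i\<in>S. \<pi> i * integral UNIV (\<lambda>t. - z i t))"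
    using limsup_determined_by_mass[OF test_fun_uminus[OF z]] by blast
  have M': "\<exists>T. \<forall>t\<ge>T. \<forall>i\<in>S. - potential z i t \<le> M' + \<eta>" if "0 < \<eta>" for \<eta>
    using M''[OF that] potential_uminus[OF z] by auto
  have M_L: "M = L (\<lambda>h. integral UNIV (z h))" by (rule L) (rule M_eq)
  have "M' = L (\<lambda>h. integral UNIV (\<lambda>t. - z h t))" by (rule L) (rule M'_eq)
  then have MM': "M' = - M" by (simp add: M_L L_def sum_negf)
  have "(potential z i \<longlongrightarrow> M) at_top"
  proof (rule tendstoI)
    fix \<epsilon> :: real assume "0 < \<epsilon>"
    then have e: "0 < \<epsilon> / 2" by simp
    obtain T T' where T: "\<And>t. T \<le> t \<Longrightarrow> potential z i t \<le> M + \<epsilon> / 2"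
      and T': "\<And>t. T' \<le> t \<Longrightarrow> - potential z i t \<le> M' + \<epsilon> / 2"
      using M[OF e] M'[OF e] i by blast
    show "\<forall>\<^sub>F t in at_top. dist (potential z i t) M < \<epsilon>"
    proof (rule eventually_at_top_linorderI[of "max T T'"])
      fix t assume "max T T' \<le> t"
      then show "dist (potential z i t) M < \<epsilon>"
        using T[of t] T'[of t] \<open>0 < \<epsilon>\<close> MM' by (auto simp: dist_real_def)
    qed
  qed
  then show ?thesis by (simp add: M_L L_def)
qed

text \<open>Extension to sources that are not continuous but are squeezed between test functions of almost the
  same mass. The solutions are ordered like their sources by the maximum principle.\<close>

theorem key_renewal_sandwich:
  assumes f0: "\<And>i t. i \<in> S \<Longrightarrow> t < -1 \<Longrightarrow> f i t = 0"
    and f: "\<And>i t. i \<in> S \<Longrightarrow> f i t = z i t + transfer f i t"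
    and approx: "\<And>\<epsilon>. 0 < \<epsilon> \<Longrightarrow> \<epsilon> \<le> 1 \<Longrightarrow> \<exists>b K zl zu. test_fun b K zl \<and> test_fun b K zu \<and>
        (\<forall>i\<in>S. (\<forall>t. zl i t \<le> z i t \<and> z i t \<le> zu i t) \<and>
          \<bar>integral UNIV (zl i) - d i\<bar> \<le> \<epsilon> * C \<and> \<bar>integral UNIV (zu i) - d i\<bar> \<le> \<epsilon> * C)"
    and i: "i \<in> S"
  shows "(f i \<longlongrightarrow> (\<Sum>h\<in>S. Re (a h / complex_mean_len a) * d h)) at_top"
proof (rule tendstoI)
  define L where "L x = (\<Sum>h\<in>S. Re (a h / complex_mean_len a) * x h)" for x
  define Q where "Q = (\<Sum>h\<in>S. \<bar>Re (a h / complex_mean_len a)\<bar>)"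
  have L: "\<bar>L x - L d\<bar> \<le> Q * c" if "\<And>h. h \<in> S \<Longrightarrow> \<bar>x h - d h\<bar> \<le> c" for x c
  proof -
    have "L x - L d = (\<Sum>h\<in>S. Re (a h / complex_mean_len a) * (x h - d h))"
      by (simp add: L_def right_diff_distrib sum_subtractf)
    also have "\<bar>\<dots>\<bar> \<le> (\<Sum>h\<in>S. \<bar>Re (a h / complex_mean_len a)\<bar> * c)"
      using that by (intro order.trans[OF sum_abs] sum_mono) (simp add: abs_mult mult_left_mono)
    finally show ?thesis by (simp add: Q_def sum_distrib_right)
  qed
  fix r :: real assume r: "0 < r"
  have C: "0 \<le> C"
  proof -
    have "0 < (1::real)" "1 \<le> (1::real)" by simp_all
    from approx[OF this] obtain zl :: "'a \<Rightarrow> real \<Rightarrow> real" where "\<bar>integral UNIV (zl i) - d i\<bar> \<le> 1 * C"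
      using i by blast
    then show ?thesis by linarith
  qed
  have Q: "0 \<le> Q" by (simp add: Q_def sum_nonneg)
  define \<epsilon> where "\<epsilon> = min 1 (r / (2 * (Q * C + 1)))"
  have QC: "0 \<le> Q * C" using Q C by simp
  have \<epsilon>: "0 < \<epsilon>" "\<epsilon> \<le> 1" using r QC by (auto simp: \<epsilon>_def)
  have "Q * (\<epsilon> * C) = Q * C * \<epsilon>" by simp
  also have "\<dots> \<le> Q * C * (r / (2 * (Q * C + 1)))" using QC by (intro mult_left_mono) (simp_all add: \<epsilon>_def)
  also have "\<dots> \<le> r / 2" using QC r by (simp add: field_simps)
  finally have small: "Q * (\<epsilon> * C) \<le> r / 2" .
  obtain b K zl zu where zl: "test_fun b K zl" and zu: "test_fun b K zu"
    and order: "\<And>i t. i \<in> S \<Longrightarrow> zl i t \<le> z i t" "\<And>i t. i \<in> S \<Longrightarrow> z i t \<le> zu i t"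
    and mass: "\<And>i. i \<in> S \<Longrightarrow> \<bar>integral UNIV (zl i) - d i\<bar> \<le> \<epsilon> * C"
      "\<And>i. i \<in> S \<Longrightarrow> \<bar>integral UNIV (zu i) - d i\<bar> \<le> \<epsilon> * C"
    using approx[OF \<epsilon>] by metis
  have upper: "f i t \<le> potential zu i t" for t
  proof -
    have "f i t - potential zu i t \<le> 0"
    proof (rule maximum_principle[where T = "-2" and f = "\<lambda>i t. f i t - potential zu i t"])
      fix i t assume g: "i \<in> S"
      show "f i t - potential zu i t \<le> transfer (\<lambda>i t. f i t - potential zu i t) i t"
        using f[OF g, of t] test_fun_renewal_equation[OF zu g, of t] order(2)[OF g, of t] by (simp add: transfer_diff)
    qed (use f0 test_fun_potential_vanishes[OF zu] i in auto)
    then show ?thesis by simp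
  qed
  have lower: "potential zl i t \<le> f i t" for t
  proof -
    have "potential zl i t - f i t \<le> 0"
    proof (rule maximum_principle[where T = "-2" and f = "\<lambda>i t. potential zl i t - f i t"])
      fix i t assume g: "i \<in> S"
      show "potential zl i t - f i t \<le> transfer (\<lambda>i t. potential zl i t - f i t) i t"
        using f[OF g, of t] test_fun_renewal_equation[OF zl g, of t] order(1)[OF g, of t] by (simp add: transfer_diff)
    qed (use f0 test_fun_potential_vanishes[OF zl] i in auto)
    then show ?thesis by simp
  qed
  have "\<forall>\<^sub>F t in at_top. dist (potential zl i t) (L (\<lambda>h. integral UNIV (zl h))) < r / 2"
    using key_renewal[OF zl i] r unfolding L_def by (intro tendstoD) auto
  moreover have "\<forall>\<^sub>F t in at_top. dist (potential zu i t) (L (\<lambda>h. integral UNIV (zu h))) < r / 2"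
    using key_renewal[OF zu i] r unfolding L_def by (intro tendstoD) auto
  ultimately have "\<forall>\<^sub>F t in at_top. dist (f i t) (L d) < r"
  proof eventually_elim
    case (elim t)
    have "\<bar>L (\<lambda>h. integral UNIV (zl h)) - L d\<bar> \<le> r / 2" "\<bar>L (\<lambda>h. integral UNIV (zu h)) - L d\<bar> \<le> r / 2"
      using L[of "\<lambda>h. integral UNIV (zl h)" "\<epsilon> * C"] L[of "\<lambda>h. integral UNIV (zu h)" "\<epsilon> * C"] mass small
      by fastforce+
    then show ?case using elim upper[of t] lower[of t] unfolding dist_real_def by linarith
  qed
  then show "\<forall>\<^sub>F t in at_top. dist (f i t) (\<Sum>h\<in>S. Re (a h / complex_mean_len a) * d h) < r"
    by (simp add: L_def)
qed

end

end

section \<open>Tiles, substitution and the semi-flow\<close>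

lemma scaled_copy_scaled_copy:
  "scaled_copy \<alpha> v (scaled_copy \<beta> w A) = scaled_copy (\<alpha> * \<beta>) (v + \<alpha> *\<^sub>R w) A"
  by (simp add: scaled_copy_def image_image algebra_simps)

lemma scaled_copy_one [simp]: "scaled_copy 1 0 A = A"
  by (simp add: scaled_copy_def)

lemma scaled_copy_eq_translation: "scaled_copy \<alpha> v A = (+) v ` ((*\<^sub>R) \<alpha> ` A)"
  by (simp add: scaled_copy_def image_image)

lemma measure_scaled_copy:
  fixes A :: "'a::euclidean_space set"
  shows "measure lebesgue (scaled_copy \<alpha> v A) = \<bar>\<alpha>\<bar> ^ DIM('a) * measure lebesgue A"
  using measure_lebesgue_affine[of \<alpha> v A] by (simp add: scaled_copy_def add.commute)

lemma lmeasurable_scaled_copy: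
  fixes A :: "'a::euclidean_space set"
  assumes "A \<in> lmeasurable" and "\<alpha> \<noteq> 0"
  shows "scaled_copy \<alpha> v A \<in> lmeasurable"
  unfolding scaled_copy_eq_translation
proof (rule measurable_translation)
  have "(*\<^sub>R) \<alpha> ` A = (*\<^sub>R) (1 / \<alpha>) -` A \<inter> space lebesgue"
    using assms(2) by (auto simp: image_iff intro!: bexI[of _ "(1 / \<alpha>) *\<^sub>R _"])
  then have "(*\<^sub>R) \<alpha> ` A \<in> sets lebesgue"
    using assms(1) by (metis fmeasurableD lebesgue_measurable_scaling measurable_sets)
  moreover have "emeasure lebesgue ((*\<^sub>R) \<alpha> ` A) < \<infinity>"
    using emeasure_lebesgue_affine[of \<alpha> 0 A] assms(1)
    by (simp add: fmeasurable_def ennreal_mult_less_top del: emeasure_completion)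
  ultimately show "(*\<^sub>R) \<alpha> ` A \<in> lmeasurable" by (rule fmeasurableI)
qed

lemma negligible_scaled_copy:
  fixes A :: "'a::euclidean_space set"
  assumes "negligible A" and "\<alpha> \<noteq> 0"
  shows "negligible (scaled_copy \<alpha> v A)"
  using assms lmeasurable_scaled_copy[of A \<alpha> v] measure_scaled_copy[of \<alpha> v A]
  by (simp add: negligible_iff_measure)

lemma scaled_copy_Int:
  fixes A :: "'a::euclidean_space set"
  assumes "\<alpha> \<noteq> 0"
  shows "scaled_copy \<alpha> v A \<inter> scaled_copy \<alpha> v B = scaled_copy \<alpha> v (A \<inter> B)"
  using assms by (auto simp: scaled_copy_def)

lemma bounded_scaled_copy: "bounded A \<Longrightarrow> bounded (scaled_copy \<alpha> v A)"
  unfolding scaled_copy_eq_translation by (intro bounded_translation bounded_scaling)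

text \<open>Iterating a nonzero period leads out of every bounded set.\<close>

lemma bounded_no_period:
  fixes A :: "'a::real_normed_vector set"
  assumes A: "bounded A" "A \<noteq> {}" and period: "\<And>x. x \<in> A \<Longrightarrow> u + x \<in> A"
  shows "u = 0"
proof (rule ccontr)
  assume "u \<noteq> 0"
  obtain B where B: "\<And>x. x \<in> A \<Longrightarrow> norm x \<le> B" using A(1) unfolding bounded_iff by blast
  obtain x where x: "x \<in> A" using A(2) by blast
  have in_A: "real m *\<^sub>R u + x \<in> A" for m
  proof (induction m)
    case (Suc m) then show ?case using period[OF Suc] by (simp add: algebra_simps)
  qed (simp add: x)
  obtain m :: nat where "2 * B / norm u < real m" using reals_Archimedean2 by blast
  then have "2 * B < norm (real m *\<^sub>R u)" using \<open>u \<noteq> 0\<close> by (simp add: field_simps)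
  moreover have "norm (real m *\<^sub>R u) \<le> norm (real m *\<^sub>R u + x) + norm x"
    using norm_triangle_ineq4[of "real m *\<^sub>R u + x" x] by simp
  ultimately show False using B[OF in_A[of m]] B[OF x] by linarith
qed

lemma scaled_copy_shift_unique:
  assumes "bounded A" "A \<noteq> {}" "scaled_copy \<alpha> v A = scaled_copy \<alpha> w A"
  shows "v = w"
proof -
  have "w - v = 0"
  proof (rule bounded_no_period)
    show "bounded (scaled_copy \<alpha> v A)" using assms by (intro bounded_scaled_copy)
    show "scaled_copy \<alpha> v A \<noteq> {}" using assms(2) by (simp add: scaled_copy_def)
    fix x assume "x \<in> scaled_copy \<alpha> v A"
    then have "(w - v) + x \<in> scaled_copy \<alpha> w A" by (auto simp: scaled_copy_def)
    then show "(w - v) + x \<in> scaled_copy \<alpha> v A" by (simp add: assms(3))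
  qed
  then show ?thesis by simp
qed

lemma negligible_Int_tiles:
  assumes "is_tile A" "is_tile B" "interior A \<inter> interior B = {}"
  shows "negligible (A \<inter> B)"
proof (rule negligible_subset)
  show "negligible (frontier A \<union> frontier B)"
    using assms by (intro negligible_Un) (simp_all add: is_tile_def negligible_iff_null_sets)
  show "A \<inter> B \<subseteq> frontier A \<union> frontier B"
    using assms(3) closure_subset unfolding frontier_def by blast
qed

lemma is_tile_lmeasurable: "is_tile A \<Longrightarrow> A \<in> lmeasurable"
  by (simp add: is_tile_def bounded_set_imp_lmeasurable)

locale tiling_scheme =
  fixes \<sigma> :: "'a::euclidean_space scheme"
  assumes multiscale: "multiscale_scheme \<sigma>"
    and normalized: "normalized_scheme \<sigma>"
    and distinct: "geometrically_distinct \<sigma>"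
begin

abbreviation n :: nat where "n \<equiv> nprotos \<sigma>"
abbreviation T :: "nat \<Rightarrow> 'a set" where "T \<equiv> proto \<sigma>"
abbreviation edges :: "nat \<Rightarrow> (nat \<times> nat) set" where "edges \<equiv> piece_index \<sigma>"

definition const :: "nat \<Rightarrow> nat \<times> nat \<Rightarrow> real" where
  "const i e = subst_const \<sigma> i (fst e) (snd e)"

definition weight :: "nat \<Rightarrow> nat \<times> nat \<Rightarrow> real" where
  "weight i e = const i e ^ DIM('a)"

definition delay :: "nat \<Rightarrow> nat \<times> nat \<Rightarrow> real" where
  "delay i e = - ln (const i e)"

lemma edges_eq: "edges i = (SIGMA j:{..<n}. {..<mult \<sigma> i j})"
  by (auto simp: piece_index_def)

lemma finite_edges: "finite (edges i)"
  unfolding edges_eq by auto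

lemma edge_target: "e \<in> edges i \<Longrightarrow> fst e < n"
  by (auto simp: piece_index_def)

lemma const_bounds: "i < n \<Longrightarrow> e \<in> edges i \<Longrightarrow> 0 < const i e \<and> const i e < 1"
  using multiscale by (auto simp: multiscale_scheme_def piece_index_def const_def)

lemma exp_delay: "i < n \<Longrightarrow> e \<in> edges i \<Longrightarrow> exp (- delay i e) = const i e"
  using const_bounds by (simp add: delay_def)

lemma T_tile: "i < n \<Longrightarrow> is_tile (T i)"
  using multiscale by (simp add: multiscale_scheme_def)

lemma T_measure: "i < n \<Longrightarrow> measure lebesgue (T i) = 1"
  using normalized by (simp add: normalized_scheme_def)

lemma T_nonempty: "i < n \<Longrightarrow> T i \<noteq> {}"
  using T_measure by fastforce

lemma piece_eq: "piece \<sigma> i e = scaled_copy (const i e) (subst_shift \<sigma> i (fst e) (snd e)) (T (fst e))"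
  by (simp add: piece_def const_def split_beta)

lemma piece_tile: "i < n \<Longrightarrow> e \<in> edges i \<Longrightarrow> is_tile (piece \<sigma> i e)"
  using multiscale by (auto simp: multiscale_scheme_def tessellation_def subst_rule_def)

lemma T_eq_Union_pieces: "i < n \<Longrightarrow> T i = (\<Union>e\<in>edges i. piece \<sigma> i e)"
  using multiscale by (auto simp: multiscale_scheme_def tessellation_def subst_rule_def)

lemma negligible_Int_pieces:
  assumes "i < n" "e \<in> edges i" "e' \<in> edges i" "e \<noteq> e'"
  shows "negligible (piece \<sigma> i e \<inter> piece \<sigma> i e')"
proof -
  have "piece \<sigma> i e \<noteq> piece \<sigma> i e'"
    using multiscale assms by (auto simp: multiscale_scheme_def inj_on_def)
  moreover have "tessellation (T i) (piece \<sigma> i ` edges i)"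
    using multiscale assms by (auto simp: multiscale_scheme_def subst_rule_def)
  ultimately have "interior (piece \<sigma> i e) \<inter> interior (piece \<sigma> i e') = {}"
    using assms unfolding tessellation_def by blast
  then show ?thesis using assms by (intro negligible_Int_tiles piece_tile)
qed

lemma weights_sum_to_1:
  assumes i: "i < n"
  shows "(\<Sum>e\<in>edges i. weight i e) = 1"
proof -
  have "1 = measure lebesgue (\<Union>(piece \<sigma> i ` edges i))"
    using T_measure[OF i] T_eq_Union_pieces[OF i] by simp
  also have "\<dots> = (\<Sum>e\<in>edges i. measure lebesgue (piece \<sigma> i e))"
    using i by (intro measure_negligible_finite_Union_image finite_edges)
      (auto simp: pairwise_def intro!: negligible_Int_pieces is_tile_lmeasurable piece_tile)
  also have "\<dots> = (\<Sum>e\<in>edges i. weight i e)"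
    using const_bounds[OF i] edge_target
    by (intro sum.cong) (auto simp: piece_eq measure_scaled_copy T_measure weight_def less_imp_le)
  finally show ?thesis by simp
qed

text \<open>The element \<open>1\<close> keeps the set nonempty when there are no prototiles, so that the extremal delays
  below are always defined and positive.\<close>

definition delays :: "real set" where
  "delays = insert 1 (\<Union>i<n. delay i ` edges i)"

text \<open>The Markov chain of the scheme: the states are the types, the edges from \<open>i\<close> are the pieces of \<open>T\<^sub>i\<close>, the
  probability of an edge is the volume of the piece and its length is minus the logarithm of its scale.\<close>

sublocale markov_renewal "{..<n}" edges fst weight delay "Min delays" "Max delays"
proof
  have fin: "finite delays" by (auto simp: delays_def finite_edges)
  have pos: "\<And>x. x \<in> delays \<Longrightarrow> 0 < x" using const_bounds by (auto simp: delays_def delay_def)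
  show "0 < Min delays" using fin pos by (subst Min_gr_iff) (auto simp: delays_def)
  fix i e assume "i \<in> {..<n}" "e \<in> edges i"
  then have "delay i e \<in> delays" by (auto simp: delays_def)
  then show "Min delays \<le> delay i e" "delay i e \<le> Max delays" using fin by auto
qed (use finite_edges edge_target const_bounds weights_sum_to_1 in \<open>auto simp: weight_def\<close>)

text \<open>The scale is read off from the volume, the type from geometric distinctness, and the translation vector
  from the boundedness of tiles.\<close>

lemma scaled_copies_eq:
  assumes "i < n" "h < n" "0 < \<alpha>" "0 < \<beta>" "scaled_copy \<alpha> v (T i) = scaled_copy \<beta> w (T h)"
  shows "i = h \<and> \<alpha> = \<beta> \<and> v = w"
proof -
  have "\<bar>\<alpha>\<bar> ^ DIM('a) = \<bar>\<beta>\<bar> ^ DIM('a)"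
    using measure_scaled_copy[of \<alpha> v "T i"] measure_scaled_copy[of \<beta> w "T h"]
      T_measure[OF assms(1)] T_measure[OF assms(2)] assms(5) by simp
  then have \<alpha>: "\<alpha> = \<beta>"
    using assms by (simp add: power_eq_iff_eq_base)
  have "scaled_copy (1 / \<alpha>) (- (1 / \<alpha>) *\<^sub>R v) (scaled_copy \<alpha> v (T i)) = T i"
    using assms(3) by (subst scaled_copy_scaled_copy) simp
  then have "T i = scaled_copy (1 / \<alpha> * \<beta>) (- (1 / \<alpha>) *\<^sub>R v + (1 / \<alpha>) *\<^sub>R w) (T h)"
    using assms(5) by (simp add: scaled_copy_scaled_copy)
  moreover have "0 < 1 / \<alpha> * \<beta>" using assms by simp
  ultimately have "i = h" using distinct assms(1,2) unfolding geometrically_distinct_def by blast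
  moreover have "v = w"
  proof (rule scaled_copy_shift_unique)
    show "bounded (T i)" "T i \<noteq> {}" using T_tile[OF assms(1)] T_nonempty[OF assms(1)] by (auto simp: is_tile_def)
    show "scaled_copy \<alpha> v (T i) = scaled_copy \<alpha> w (T i)" using assms(5) \<alpha> \<open>i = h\<close> by metis
  qed
  ultimately show ?thesis using \<alpha> by blast
qed

lemma tile_of_type_iff:
  assumes "i < n" "0 < \<alpha>"
  shows "tile_of_type \<sigma> j \<beta> (scaled_copy \<alpha> v (T i)) \<longleftrightarrow> i = j \<and> \<alpha> = \<beta>"
  unfolding tile_of_type_def using assms scaled_copies_eq[of i j \<alpha> \<beta> v] by blast

text \<open>The pieces of the tile \<open>v + e\<^sup>t T\<^sub>i\<close>, written again with the exponential of a time as scale.\<close>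

definition child :: "nat \<Rightarrow> real \<Rightarrow> 'a \<Rightarrow> nat \<times> nat \<Rightarrow> 'a set" where
  "child i t v e = scaled_copy (exp (t - delay i e))
     (v + exp t *\<^sub>R subst_shift \<sigma> i (fst e) (snd e)) (T (fst e))"

lemma child_eq:
  assumes "i < n" "e \<in> edges i"
  shows "child i t v e = scaled_copy (exp t) v (piece \<sigma> i e)"
  unfolding child_def piece_eq scaled_copy_scaled_copy
  using exp_delay[OF assms] exp_add[of t "- delay i e"] by simp

lemma subst_tile_eq:
  assumes i: "i < n"
  shows "subst_tile \<sigma> (scaled_copy (exp t) v (T i)) = child i t v ` edges i"
proof -
  have "subst_tile \<sigma> (scaled_copy (exp t) v (T i)) = scaled_copy (exp t) v ` subst_rule \<sigma> i"
  proof (intro equalityI subsetI)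
    fix A assume "A \<in> subst_tile \<sigma> (scaled_copy (exp t) v (T i))"
    then obtain h \<beta> w B where "h < n" "0 < \<beta>" "scaled_copy (exp t) v (T i) = scaled_copy \<beta> w (T h)"
      and B: "B \<in> subst_rule \<sigma> h" "A = scaled_copy \<beta> w B"
      unfolding subst_tile_def by blast
    then have "i = h \<and> exp t = \<beta> \<and> v = w" using i by (intro scaled_copies_eq) auto
    then show "A \<in> scaled_copy (exp t) v ` subst_rule \<sigma> i" using B by blast
  next
    fix A assume "A \<in> scaled_copy (exp t) v ` subst_rule \<sigma> i"
    then show "A \<in> subst_tile \<sigma> (scaled_copy (exp t) v (T i))"
      unfolding subst_tile_def using i exp_gt_zero[of t] by blast
  qed
  then show ?thesis using child_eq[OF i] by (simp add: subst_rule_def image_image cong: image_cong)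
qed

lemma measure_scaled_proto: "i < n \<Longrightarrow> measure lebesgue (scaled_copy (exp t) v (T i)) = exp (real DIM('a) * t)"
  by (simp add: measure_scaled_copy T_measure exp_of_nat_mult)

lemma subst_step_single:
  assumes "i < n"
  shows "subst_step \<sigma> {scaled_copy (exp t) v (T i)}
    = (if 0 < t then child i t v ` edges i else {scaled_copy (exp t) v (T i)})"
  using assms by (simp add: subst_step_def measure_scaled_proto subst_tile_eq zero_less_mult_iff)

lemma subst_step_power_UN: "(subst_step \<sigma> ^^ N) (\<Union>e\<in>I. X e) = (\<Union>e\<in>I. (subst_step \<sigma> ^^ N) (X e))"
proof (induction N arbitrary: X)
  case (Suc N)
  have "subst_step \<sigma> (\<Union>e\<in>I. X e) = (\<Union>e\<in>I. subst_step \<sigma> (X e))" for X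
    unfolding subst_step_def by blast
  then show ?case using Suc by (simp add: funpow_Suc_right del: funpow.simps)
qed simp

lemma subst_step_power_Suc:
  assumes "i < n" "0 < t"
  shows "(subst_step \<sigma> ^^ Suc N) {scaled_copy (exp t) v (T i)}
    = (\<Union>e\<in>edges i. (subst_step \<sigma> ^^ N) {child i t v e})"
proof -
  have "(subst_step \<sigma> ^^ Suc N) {scaled_copy (exp t) v (T i)}
      = (subst_step \<sigma> ^^ N) (\<Union>e\<in>edges i. {child i t v e})"
    using assms by (simp add: funpow_Suc_right subst_step_single UNION_singleton_eq_range del: funpow.simps)
  then show ?thesis by (simp only: subst_step_power_UN)
qed

lemma subst_step_power_small:
  assumes "i < n" "t \<le> 0"
  shows "(subst_step \<sigma> ^^ N) {scaled_copy (exp t) v (T i)} = {scaled_copy (exp t) v (T i)}"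
  using assms by (induction N) (auto simp: subst_step_single)

text \<open>A tile that appears in the patch records the path of substitutions that led to it.\<close>

lemma tile_in_iterate:
  assumes "A \<in> (subst_step \<sigma> ^^ N) {scaled_copy (exp t) v (T i)}" and "i < n"
  shows "\<exists>h s w. h < n \<and> path i h s \<and> A = scaled_copy (exp (t - s)) w (T h)"
  using assms
proof (induction N arbitrary: i t v)
  case 0
  then have "A = scaled_copy (exp (t - 0)) v (T i)" by simp
  then show ?case using path_refl[of i] 0 by blast
next
  case (Suc N)
  show ?case
  proof (cases "0 < t")
    case True
    then obtain e where e: "e \<in> edges i" and A: "A \<in> (subst_step \<sigma> ^^ N) {child i t v e}"
      using Suc.prems subst_step_power_Suc[of i t N v] by blast
    obtain h s w where "h < n" "path (fst e) h s" "A = scaled_copy (exp (t - delay i e - s)) w (T h)"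
      using Suc.IH[OF A[unfolded child_def]] edge_target[OF e] by blast
    then show ?thesis using path_step[OF e] by (metis diff_diff_eq)
  next
    case False
    then have "A = scaled_copy (exp (t - 0)) v (T i)"
      using Suc.prems subst_step_power_small[of i t "Suc N" v] by simp
    then show ?thesis using path_refl[of i] Suc.prems by blast
  qed
qed

lemma covered_volume_single:
  assumes "i < n"
  shows "measure lebesgue (\<Union>{A \<in> {scaled_copy (exp t) v (T i)}. \<exists>\<alpha>\<in>{a..b}. tile_of_type \<sigma> j \<alpha> A})
    = (if i = j \<and> exp t \<in> {a..b} then exp (real DIM('a) * t) else 0)"
proof -
  have "{A \<in> {scaled_copy (exp t) v (T i)}. \<exists>\<alpha>\<in>{a..b}. tile_of_type \<sigma> j \<alpha> A}
      = (if i = j \<and> exp t \<in> {a..b} then {scaled_copy (exp t) v (T i)} else {})"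
    using tile_of_type_iff[OF assms exp_gt_zero, of j _ t v] by auto
  then show ?thesis by (simp only:) (use measure_scaled_proto[OF assms, of t v] in auto)
qed

text \<open>Substituting the first tile splits the patch into the patches of its pieces, which overlap in null
  sets only; volumes of selected tiles therefore add up, and after division by the total volume this
  addition is the renewal equation. Since every piece starts earlier by its delay, \<open>N\<close> steps settle all
  times up to \<open>N\<close> times the smallest delay. Arbitrary translates \<open>v\<close> are needed in the induction.\<close>

lemma covered_volume_iterate:
  fixes W :: "nat \<Rightarrow> real \<Rightarrow> real" and v :: 'a
  assumes initial: "\<And>i t. i < n \<Longrightarrow> t \<le> 0 \<Longrightarrow> W i t = (if i = j \<and> exp t \<in> {a..b} then 1 else 0)"
    and renewal: "\<And>i t. i < n \<Longrightarrow> 0 < t \<Longrightarrow> W i t = transfer W i t"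
    and i: "i < n" and t: "t \<le> real N * Min delays"
  defines "P \<equiv> (subst_step \<sigma> ^^ N) {scaled_copy (exp t) v (T i)}"
  shows "finite P \<and> (\<forall>A\<in>P. A \<in> lmeasurable \<and> measure lebesgue A \<le> 1 \<and> A \<subseteq> scaled_copy (exp t) v (T i)) \<and>
    measure lebesgue (\<Union>{A \<in> P. \<exists>\<alpha>\<in>{a..b}. tile_of_type \<sigma> j \<alpha> A}) = exp (real DIM('a) * t) * W i t"
  using i t unfolding P_def
proof (induction N arbitrary: i t v)
  case base: 0
  then have "t \<le> 0" by simp
  then show ?case
    using base covered_volume_single[of i t v a b j] initial[of i t] measure_scaled_proto[of i t v]
    by (auto simp: is_tile_lmeasurable T_tile intro!: lmeasurable_scaled_copy mult_nonneg_nonpos)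
next
  case (Suc N)
  show ?case
  proof (cases "0 < t")
    case False
    then show ?thesis
      using Suc.prems subst_step_power_small[of i t "Suc N" v]
        covered_volume_single[of i t v a b j] initial[of i t] measure_scaled_proto[of i t v]
      by (auto simp: is_tile_lmeasurable T_tile simp del: funpow.simps
          intro!: lmeasurable_scaled_copy mult_nonneg_nonpos)
  next
    case True
    define R where "R e = (subst_step \<sigma> ^^ N) {child i t v e}" for e
    define B where "B e = \<Union>{A \<in> R e. \<exists>\<alpha>\<in>{a..b}. tile_of_type \<sigma> j \<alpha> A}" for e
    have IH: "finite (R e)" "\<And>A. A \<in> R e \<Longrightarrow> A \<in> lmeasurable \<and> measure lebesgue A \<le> 1 \<and> A \<subseteq> child i t v e"
      "measure lebesgue (B e) = exp (real DIM('a) * (t - delay i e)) * W (fst e) (t - delay i e)"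
      if e: "e \<in> edges i" for e
    proof -
      have "t - delay i e \<le> real N * Min delays"
        using Suc.prems len_ge[of i e] e by (simp add: algebra_simps)
      from Suc.IH[OF edge_target[OF e] this]
      show "finite (R e)" "\<And>A. A \<in> R e \<Longrightarrow> A \<in> lmeasurable \<and> measure lebesgue A \<le> 1 \<and> A \<subseteq> child i t v e"
        "measure lebesgue (B e) = exp (real DIM('a) * (t - delay i e)) * W (fst e) (t - delay i e)"
        unfolding R_def B_def child_def by blast+
    qed
    have P: "(subst_step \<sigma> ^^ Suc N) {scaled_copy (exp t) v (T i)} = (\<Union>e\<in>edges i. R e)"
      unfolding R_def by (rule subst_step_power_Suc[OF Suc.prems(1) True])
    have BR: "B e \<subseteq> child i t v e" if "e \<in> edges i" for e
      unfolding B_def using IH(2)[OF that] by blast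
    have "\<Union>{A \<in> \<Union>e\<in>edges i. R e. \<exists>\<alpha>\<in>{a..b}. tile_of_type \<sigma> j \<alpha> A} = \<Union>(B ` edges i)"
      unfolding B_def by blast
    also have "measure lebesgue \<dots> = (\<Sum>e\<in>edges i. measure lebesgue (B e))"
    proof (intro measure_negligible_finite_Union_image finite_edges pairwiseI)
      fix e assume e: "e \<in> edges i"
      show "B e \<in> lmeasurable"
        unfolding B_def using IH(1,2)[OF e] by (intro fmeasurable.finite_Union) auto
    next
      fix e e' assume e: "e \<in> edges i" "e' \<in> edges i" "e \<noteq> e'"
      have "negligible (scaled_copy (exp t) v (piece \<sigma> i e \<inter> piece \<sigma> i e'))"
        using e Suc.prems(1) by (intro negligible_scaled_copy negligible_Int_pieces) auto
      moreover have "B e \<inter> B e' \<subseteq> scaled_copy (exp t) v (piece \<sigma> i e \<inter> piece \<sigma> i e')"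
        using BR[OF e(1)] BR[OF e(2)] child_eq[OF Suc.prems(1) e(1)] child_eq[OF Suc.prems(1) e(2)]
        by (subst scaled_copy_Int[symmetric, OF exp_not_eq_zero]) auto
      ultimately show "negligible (B e \<inter> B e')" using negligible_subset by blast
    qed
    also have "\<dots> = (\<Sum>e\<in>edges i. exp (real DIM('a) * t) * (weight i e * W (fst e) (t - delay i e)))"
    proof (rule sum.cong[OF refl])
      fix e assume e: "e \<in> edges i"
      have "exp (real DIM('a) * (t - delay i e)) = exp (real DIM('a) * t) * exp (- delay i e) ^ DIM('a)"
        by (simp add: right_diff_distrib exp_diff exp_minus field_simps flip: exp_of_nat_mult)
      then show "measure lebesgue (B e) = exp (real DIM('a) * t) * (weight i e * W (fst e) (t - delay i e))"
        using IH(3)[OF e] exp_delay[OF Suc.prems(1) e] by (simp add: weight_def)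
    qed
    also have "\<dots> = exp (real DIM('a) * t) * W i t"
      using renewal[OF Suc.prems(1) True] by (simp add: transfer_apply sum_distrib_left)
    finally have measure: "measure lebesgue (\<Union>{A \<in> \<Union>e\<in>edges i. R e. \<exists>\<alpha>\<in>{a..b}. tile_of_type \<sigma> j \<alpha> A})
        = exp (real DIM('a) * t) * W i t" .
    have "child i t v e \<subseteq> scaled_copy (exp t) v (T i)" if "e \<in> edges i" for e
      using that T_eq_Union_pieces[OF Suc.prems(1)]
      unfolding child_eq[OF Suc.prems(1) that] by (auto simp: scaled_copy_def)
    then show ?thesis
      unfolding P using measure IH(1,2) finite_edges by blast
  qed
qed

lemma subst_step_idle: "\<forall>A\<in>P. measure lebesgue A \<le> 1 \<Longrightarrow> (subst_step \<sigma> ^^ N) P = P"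
proof (induction N)
  case (Suc N)
  then have "(subst_step \<sigma> ^^ N) P = P" by blast
  moreover have "subst_step \<sigma> P = P" using Suc.prems by (force simp: subst_step_def split: if_splits)
  ultimately show ?case by simp
qed simp

text \<open>Once all tiles have volume at most one, further steps change nothing, so the patch at which the loop
  stops can be compared with any sufficiently high iterate.\<close>

lemma flow_eq_iterate:
  assumes i: "i < n" and t: "t \<le> real N * Min delays"
  shows "flow \<sigma> t i = (subst_step \<sigma> ^^ N) {scaled_copy (exp t) 0 (T i)}"
proof -
  let ?b = "\<lambda>P. \<exists>S\<in>P. measure lebesgue S > 1" and ?s = "{scaled_copy (exp t) 0 (T i)}"
  have "\<forall>A \<in> (subst_step \<sigma> ^^ N) ?s. measure lebesgue A \<le> 1"
  proof -
    \<comment> \<open>For an empty set of scales the covered fraction is zero; only the bound on the volumes is of interest.\<close>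
    define z where "z i t = (0::real)" for i :: nat and t :: real
    have "z i t = 0" for i t by (simp add: z_def)
    then show ?thesis
      using covered_volume_iterate[of z 0 1 0 i t N 0] i t by (auto simp: transfer_apply)
  qed
  then have stop: "\<not> ?b ((subst_step \<sigma> ^^ N) ?s)" by (auto simp: not_less)
  then have "\<exists>k. \<not> ?b ((subst_step \<sigma> ^^ k) ?s)" by blast
  then have "while_option ?b (subst_step \<sigma>) ?s
      = Some ((subst_step \<sigma> ^^ (LEAST k. \<not> ?b ((subst_step \<sigma> ^^ k) ?s))) ?s)"
    unfolding while_option_def by (rule if_P)
  then obtain P where P: "while_option ?b (subst_step \<sigma>) ?s = Some P" by (rule that)
  obtain k where k: "P = (subst_step \<sigma> ^^ k) ?s" "\<not> ?b P" using while_option_stop2[OF P] by (elim exE conjE)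
  have "flow \<sigma> t i = P" unfolding flow_def while_def P by (rule option.sel)
  also have "\<dots> = (subst_step \<sigma> ^^ N) P" by (rule subst_step_idle[symmetric]) (use k(2) in \<open>auto simp: not_less\<close>)
  also have "\<dots> = (subst_step \<sigma> ^^ k) ((subst_step \<sigma> ^^ N) ?s)"
  proof -
    have "(subst_step \<sigma> ^^ N) ((subst_step \<sigma> ^^ k) ?s) = (subst_step \<sigma> ^^ (N + k)) ?s"
      "(subst_step \<sigma> ^^ k) ((subst_step \<sigma> ^^ N) ?s) = (subst_step \<sigma> ^^ (k + N)) ?s"
      by (simp_all only: funpow_add o_apply)
    then show ?thesis by (simp only: k(1) add.commute)
  qed
  also have "\<dots> = (subst_step \<sigma> ^^ N) ?s" by (rule subst_step_idle) (use stop in \<open>auto simp: not_less\<close>)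
  finally show ?thesis .
qed

lemma tile_in_flow:
  assumes "A \<in> flow \<sigma> t i" "i < n"
  shows "\<exists>h s w. h < n \<and> path i h s \<and> A = scaled_copy (exp (t - s)) w (T h)"
proof -
  obtain N where "t < 0 + real N * Min delays" using exists_bound_nat by blast
  then have "flow \<sigma> t i = (subst_step \<sigma> ^^ N) {scaled_copy (exp t) 0 (T i)}"
    using assms by (intro flow_eq_iterate) auto
  then show ?thesis using tile_in_iterate assms by blast
qed

lemma covered_volume_eq:
  fixes W :: "nat \<Rightarrow> real \<Rightarrow> real"
  assumes "\<And>i t. i < n \<Longrightarrow> t \<le> 0 \<Longrightarrow> W i t = (if i = j \<and> exp t \<in> {a..b} then 1 else 0)"
    and "\<And>i t. i < n \<Longrightarrow> 0 < t \<Longrightarrow> W i t = transfer W i t" and i: "i < n"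
  shows "covered_volume \<sigma> i j a b t = exp (real DIM('a) * t) * W i t"
proof -
  obtain N where "t < 0 + real N * Min delays" using exists_bound_nat by blast
  then have N: "t \<le> real N * Min delays" by simp
  have "measure lebesgue (\<Union>{A \<in> (subst_step \<sigma> ^^ N) {scaled_copy (exp t) 0 (T i)}.
      \<exists>\<alpha>\<in>{a..b}. tile_of_type \<sigma> j \<alpha> A}) = exp (real DIM('a) * t) * W i t"
    by (rule covered_volume_iterate[where W = W and j = j and a = a and b = b and i = i and t = t
          and N = N and v = 0, THEN conjunct2, THEN conjunct2]) (fact assms N)+
  then show ?thesis by (simp only: covered_volume_def flow_eq_iterate[OF i N])
qed

end

section \<open>The invariant vector in the adjugate\<close>

context nonarithmetic_renewal
begin

text \<open>If the maximum is attained at some \<open>i \<noteq> g\<close>, then it is attained at the targets of all edges from \<open>i\<close>. A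
  path to \<open>g\<close> therefore carries the maximum to \<open>g\<close>.\<close>

lemma harmonic_le_boundary:
  assumes g: "g \<in> S" and harmonic: "\<And>i. i \<in> S \<Longrightarrow> i \<noteq> g \<Longrightarrow> f i = (\<Sum>e\<in>E i. p i e * f (tgt e))"
    and i: "i \<in> S"
  shows "f i \<le> (f g :: real)"
proof -
  define M where "M = Max (f ` S)"
  have le: "f i \<le> M" if "i \<in> S" for i using that finite_S by (simp add: M_def)
  have "M \<in> f ` S" unfolding M_def using finite_S i by (intro Max_in) auto
  then obtain m where m: "m \<in> S" "f m = M" by auto
  have "f h = M" if "path i h s" "h = g" "i \<in> S" "f i = M" for i h s
    using that
  proof (induction rule: path.induct)
    case (path_step e i h s)
    show ?case
    proof (cases "i = g")
      case False
      have "f (tgt e) = M"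
      proof (rule ccontr)
        assume "f (tgt e) \<noteq> M"
        then have "f (tgt e) < M" using le tgt_S path_step by force
        then have "(\<Sum>e\<in>E i. p i e * f (tgt e)) < (\<Sum>e\<in>E i. p i e * M)"
          using path_step le tgt_S p_pos finite_E
          by (intro sum_strict_mono_ex1) (auto intro!: mult_left_mono bexI[of _ e] simp: less_imp_le)
        also have "\<dots> = M" using p_sum path_step by (simp flip: sum_distrib_right)
        finally show False using harmonic[of i] False path_step by simp
      qed
      then show ?thesis using path_step tgt_S by auto
    qed (use path_step in auto)
  qed auto
  then have "f g = M" using connected[OF m(1) g] m by blast
  then show ?thesis using le i by simp
qed

lemma harmonic_constant:
  fixes f :: "'a \<Rightarrow> complex"
  assumes g: "g \<in> S" and harmonic: "\<And>i. i \<in> S \<Longrightarrow> i \<noteq> g \<Longrightarrow> f i = (\<Sum>e\<in>E i. of_real (p i e) * f (tgt e))"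
    and i: "i \<in> S"
  shows "f i = f g"
proof -
  have *: "Re (c * f i) \<le> Re (c * f g)" for c
  proof (rule harmonic_le_boundary[OF g _ i])
    fix i assume "i \<in> S" "i \<noteq> g"
    then have "c * f i = (\<Sum>e\<in>E i. of_real (p i e) * (c * f (tgt e)))"
      using harmonic[of i] by (simp add: sum_distrib_left mult_ac)
    moreover have "Re (of_real r * z) = r * Re z" for r z by simp
    ultimately show "Re (c * f i) = (\<Sum>e\<in>E i. p i e * Re (c * f (tgt e)))" by (simp only: Re_sum)
  qed
  \<comment> \<open>These four factors extract plus and minus the real and the imaginary part.\<close>
  show ?thesis using *[of 1] *[of "-1"] *[of \<i>] *[of "- \<i>"] by (simp add: complex_eq_iff)
qed

end

locale incommensurable_tiling = tiling_scheme +
  assumes irreducible: "irreducible_scheme \<sigma>" and incommensurable: "incommensurable_scheme \<sigma>"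
begin

lemma path_to_type:
  assumes "A \<in> flow \<sigma> t i" "tile_of_type \<sigma> h \<alpha> A" "i < n"
  shows "\<exists>s. path i h s \<and> measure lebesgue A = exp (real DIM('a) * (t - s))"
proof -
  obtain g s w where g: "g < n" "path i g s" and A: "A = scaled_copy (exp (t - s)) w (T g)"
    using tile_in_flow assms by blast
  then have "g = h" using assms(2) tile_of_type_iff[OF g(1)] by simp
  then show ?thesis using g measure_scaled_proto[OF g(1)] A by blast
qed

lemma unit_return_path:
  assumes "unit_return \<sigma> i t" "i < n"
  shows "path i i t"
proof -
  obtain A \<alpha> where "A \<in> flow \<sigma> t i" "tile_of_type \<sigma> i \<alpha> A" "measure lebesgue A = 1"
    using assms(1) unfolding unit_return_def by blast
  then obtain s where "path i i s" "exp (real DIM('a) * (t - s)) = 1" using path_to_type assms(2) by metis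
  then show ?thesis by simp
qed

sublocale nonarithmetic_renewal "{..<n}" edges fst weight delay "Min delays" "Max delays"
proof
  fix i h assume "i \<in> {..<n}" "h \<in> {..<n}"
  then show "\<exists>s. path i h s"
    using irreducible path_to_type unfolding irreducible_scheme_def by (metis lessThan_iff)
next
  obtain g g' u v where *: "g < n" "g' < n" "0 < u" "0 < v" "\<not> (\<exists>q\<in>\<rat>. u = q * v)"
    "unit_return \<sigma> g u" "unit_return \<sigma> g' v"
    using incommensurable unfolding incommensurable_scheme_def by blast
  have "u = u / v * v" using * by simp
  then have "u / v \<notin> \<rat>" using *(5) by blast
  then show "\<exists>g\<in>{..<n}. \<exists>g'\<in>{..<n}. \<exists>u>0. \<exists>v>0. u / v \<notin> \<rat> \<and> path g g u \<and> path g' g' v"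
    using * unit_return_path by (meson lessThan_iff)
qed

lemma n_pos: "0 < n"
  using S_nonempty by auto

definition I_minus_M :: "complex mat" where "I_minus_M = 1\<^sub>m n - graph_matrix \<sigma> (of_nat DIM('a))"

lemma I_minus_M_carrier: "I_minus_M \<in> carrier_mat n n"
  unfolding I_minus_M_def graph_matrix_def by (intro minus_carrier_mat) auto

lemma sum_edges: "(\<Sum>e\<in>edges i. f e) = (\<Sum>j<n. \<Sum>k<mult \<sigma> i j. f (j, k))"
  unfolding edges_eq by (subst sum.Sigma) auto

lemma const_powr:
  assumes "i < n" "j < n" "k < mult \<sigma> i j"
  shows "complex_of_real (subst_const \<sigma> i j k) powr of_nat DIM('a) = of_real (weight i (j, k))"
proof -
  have "0 < subst_const \<sigma> i j k"
    using const_bounds[of i "(j, k)"] assms by (simp add: const_def piece_index_def)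
  then show ?thesis by (simp add: powr_nat' weight_def const_def)
qed

lemma I_minus_M_mult_vector:
  assumes i: "i < n"
  shows "(\<Sum>j<n. I_minus_M $$ (i, j) * x j) = x i - (\<Sum>e\<in>edges i. of_real (weight i e) * x (fst e))"
proof -
  have "(\<Sum>j<n. I_minus_M $$ (i, j) * x j) = (\<Sum>j<n. (if i = j then x j else 0)
      - (\<Sum>k<mult \<sigma> i j. of_real (weight i (j, k)) * x j))"
    using i by (intro sum.cong) (auto simp: I_minus_M_def graph_matrix_def const_powr left_diff_distrib sum_distrib_right)
  then show ?thesis using i by (simp add: sum_subtractf sum_edges)
qed

lemma I_minus_M_kernel:
  assumes "\<And>i. i < n \<Longrightarrow> (\<Sum>j<n. I_minus_M $$ (i, j) * x j) = 0" and "i < n"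
  shows "x i = x 0"
  using assms n_pos I_minus_M_mult_vector[of _ x]
  by (intro harmonic_constant) auto

text \<open>The vector \<open>(1, \<dots>, 1)\<close> is in the kernel, since the volumes of the pieces add up to one.\<close>

lemma det_I_minus_M: "det I_minus_M = 0"
proof -
  have "I_minus_M *\<^sub>v vec n (\<lambda>_. 1) = 0\<^sub>v n"
  proof (intro eq_vecI)
    fix i assume "i < dim_vec (0\<^sub>v n)"
    then have i: "i < n" by simp
    have "(\<Sum>e\<in>edges i. complex_of_real (weight i e)) = 1"
      using weights_sum_to_1[OF i] by (simp flip: of_real_sum)
    then show "(I_minus_M *\<^sub>v vec n (\<lambda>_. 1)) $ i = 0\<^sub>v n $ i"
      using i I_minus_M_carrier I_minus_M_mult_vector[OF i, of "\<lambda>_. 1"]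
      by (simp add: scalar_prod_def atLeast0LessThan)
  qed (use I_minus_M_carrier in auto)
  moreover have "vec n (\<lambda>_. 1) \<noteq> (0\<^sub>v n :: complex vec)"
  proof
    assume "vec n (\<lambda>_. 1) = (0\<^sub>v n :: complex vec)"
    then have "vec n (\<lambda>_. 1) $ 0 = (0\<^sub>v n :: complex vec) $ 0" by simp
    then show False using n_pos by simp
  qed
  ultimately show ?thesis
    using det_0_iff_vec_prod_zero[OF I_minus_M_carrier] by (meson vec_carrier)
qed

text \<open>Any row of the adjugate would do, since they all coincide; the first one exists because there is a
  prototile.\<close>

definition adj_row :: "nat \<Rightarrow> complex" where "adj_row h = adj_mat I_minus_M $$ (0, h)"

lemma adj_carrier: "adj_mat I_minus_M \<in> carrier_mat n n"
  using adj_mat(1)[OF I_minus_M_carrier] .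

text \<open>Every column of the adjugate lies in the kernel of \<open>I - M\<^sub>\<sigma>(d)\<close>, which consists of constant vectors.\<close>

lemma adj_constant_columns:
  assumes "i < n" "h < n"
  shows "adj_mat I_minus_M $$ (i, h) = adj_row h"
  unfolding adj_row_def
proof (rule I_minus_M_kernel[OF _ assms(1)])
  fix i assume i: "i < n"
  have "(\<Sum>j<n. I_minus_M $$ (i, j) * adj_mat I_minus_M $$ (j, h)) = (I_minus_M * adj_mat I_minus_M) $$ (i, h)"
    using i assms I_minus_M_carrier adj_carrier by (simp add: scalar_prod_def atLeast0LessThan)
  also have "\<dots> = 0" using adj_mat(2)[OF I_minus_M_carrier] det_I_minus_M i assms by simp
  finally show "(\<Sum>j<n. I_minus_M $$ (i, j) * adj_mat I_minus_M $$ (j, h)) = 0" .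
qed

text \<open>The product of the adjugate with \<open>I - M\<^sub>\<sigma>(d)\<close> in the other order vanishes too.\<close>

lemma adj_row_invariant: "(\<Sum>i<n. adj_row i * (\<Sum>e\<in>edges i. of_real (weight i e) * x (fst e))) = (\<Sum>i<n. adj_row i * x i)"
proof -
  have col: "(\<Sum>i<n. adj_row i * I_minus_M $$ (i, j)) = 0" if j: "j < n" for j
  proof -
    have "(\<Sum>i<n. adj_row i * I_minus_M $$ (i, j)) = (adj_mat I_minus_M * I_minus_M) $$ (0, j)"
      using j n_pos I_minus_M_carrier adj_carrier by (simp add: scalar_prod_def atLeast0LessThan adj_row_def)
    also have "\<dots> = 0" using adj_mat(3)[OF I_minus_M_carrier] det_I_minus_M j n_pos by simp
    finally show ?thesis .
  qed
  have "(\<Sum>i<n. adj_row i * (x i - (\<Sum>e\<in>edges i. of_real (weight i e) * x (fst e))))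
      = (\<Sum>i<n. adj_row i * (\<Sum>j<n. I_minus_M $$ (i, j) * x j))"
    by (intro sum.cong refl) (simp add: I_minus_M_mult_vector)
  also have "\<dots> = (\<Sum>j<n. (\<Sum>i<n. adj_row i * I_minus_M $$ (i, j)) * x j)"
    unfolding sum_distrib_left sum_distrib_right by (subst sum.swap) (simp add: mult.assoc)
  also have "\<dots> = 0" using col by simp
  finally show ?thesis by (simp add: right_diff_distrib sum_subtractf)
qed

lemma adj_row_stationary: "stationary (\<lambda>i. Re (adj_row i))" "stationary (\<lambda>i. Im (adj_row i))"
proof -
  have *: "(\<Sum>i<n. adj_row i * of_real (\<Sum>e\<in>edges i. weight i e * f (fst e))) = (\<Sum>i<n. adj_row i * of_real (f i))" for f
    using adj_row_invariant[of "\<lambda>i. of_real (f i)"] by simp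
  show "stationary (\<lambda>i. Re (adj_row i))"
    unfolding stationary_def
  proof
    fix f show "(\<Sum>i<n. Re (adj_row i) * (\<Sum>e\<in>edges i. weight i e * f (fst e))) = (\<Sum>i<n. Re (adj_row i) * f i)"
      using arg_cong[OF *[of f], of Re] by (simp del: of_real_sum of_real_mult)
  qed
  show "stationary (\<lambda>i. Im (adj_row i))"
    unfolding stationary_def
  proof
    fix f show "(\<Sum>i<n. Im (adj_row i) * (\<Sum>e\<in>edges i. weight i e * f (fst e))) = (\<Sum>i<n. Im (adj_row i) * f i)"
      using arg_cong[OF *[of f], of Im] by (simp del: of_real_sum of_real_mult)
  qed
qed

text \<open>This entry is the minor with the first row and column removed. A vector in the kernel of the
  submatrix, extended by zero, is harmonic off the first state and vanishes there, so it is zero.\<close>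

lemma adj_row_0_nonzero: "adj_row 0 \<noteq> 0"
proof
  assume "adj_row 0 = 0"
  define D where "D = mat_delete I_minus_M 0 0"
  obtain m where m: "n = Suc m" using n_pos gr0_implies_Suc by blast
  have D: "D \<in> carrier_mat m m" using I_minus_M_carrier m by (auto simp: D_def mat_delete_def)
  have "det D = 0"
    using \<open>adj_row 0 = 0\<close> I_minus_M_carrier n_pos by (simp add: adj_row_def adj_mat_def cofactor_def D_def)
  then obtain v where v: "v \<in> carrier_vec m" "v \<noteq> 0\<^sub>v m" "D *\<^sub>v v = 0\<^sub>v m"
    using det_0_iff_vec_prod_zero[OF D] by blast
  define x where "x i = (case i of 0 \<Rightarrow> 0 | Suc i \<Rightarrow> v $ i)" for i
  have row: "(\<Sum>j<n. I_minus_M $$ (i, j) * x j) = 0" if i: "i < n" "i \<noteq> 0" for i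
  proof -
    obtain i' where i': "i = Suc i'" "i' < m" using i m by (cases i) auto
    have "(\<Sum>j<n. I_minus_M $$ (i, j) * x j) = (\<Sum>j<m. I_minus_M $$ (Suc i', Suc j) * v $ j)"
      unfolding m i'(1) by (subst sum.lessThan_Suc_shift) (simp add: x_def)
    also have "\<dots> = (\<Sum>j<m. D $$ (i', j) * v $ j)"
      using i' I_minus_M_carrier m by (intro sum.cong) (auto simp: D_def mat_delete_def)
    also have "\<dots> = (D *\<^sub>v v) $ i'" using i' D v(1) by (simp add: scalar_prod_def atLeast0LessThan)
    finally show ?thesis using v(3) i' by simp
  qed
  have const: "x i = x 0" if "i < n" for i
    using that n_pos row I_minus_M_mult_vector[of _ x] by (intro harmonic_constant) auto
  have "v $ i = 0" if "i < m" for i using const[of "Suc i"] that m by (simp add: x_def)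
  then have "v = 0\<^sub>v m" using v(1) by (intro eq_vecI) auto
  then show False using v(2) by simp
qed

lemma adj_row_nonzero: "\<exists>h\<in>{..<n}. adj_row h \<noteq> 0"
  using adj_row_0_nonzero n_pos by blast

lemma graph_matrix_deriv_entry:
  assumes "i < n" "j < n"
  shows "graph_matrix_deriv \<sigma> (of_nat DIM('a)) $$ (i, j) = - of_real (\<Sum>k<mult \<sigma> i j. weight i (j, k) * delay i (j, k))"
proof -
  have pos: "0 < subst_const \<sigma> i j k" if "k < mult \<sigma> i j" for k
    using const_bounds[of i "(j, k)"] assms that by (simp add: const_def piece_index_def)
  have eq: "(\<lambda>z. graph_matrix \<sigma> z $$ (i, j)) = (\<lambda>z. \<Sum>k<mult \<sigma> i j. complex_of_real (subst_const \<sigma> i j k) powr z)"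
    using assms by (simp add: graph_matrix_def)
  have "((\<lambda>z. \<Sum>k<mult \<sigma> i j. complex_of_real (subst_const \<sigma> i j k) powr z) has_field_derivative
      (\<Sum>k<mult \<sigma> i j. Ln (complex_of_real (subst_const \<sigma> i j k)) * complex_of_real (subst_const \<sigma> i j k) powr (of_nat DIM('a)))) (at (of_nat DIM('a)))"
    using pos by (intro DERIV_sum has_field_derivative_powr_right) fastforce
  then have "graph_matrix_deriv \<sigma> (of_nat DIM('a)) $$ (i, j) =
      (\<Sum>k<mult \<sigma> i j. Ln (complex_of_real (subst_const \<sigma> i j k)) * complex_of_real (subst_const \<sigma> i j k) powr (of_nat DIM('a)))"
    using assms unfolding graph_matrix_deriv_def by (simp add: eq DERIV_imp_deriv)
  also have "\<dots> = (\<Sum>k<mult \<sigma> i j. - of_real (weight i (j, k) * delay i (j, k)))"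
    using pos assms by (intro sum.cong) (auto simp: const_powr Ln_of_real delay_def const_def)
  finally show ?thesis by (simp add: sum_negf)
qed

text \<open>The derivative of \<open>\<alpha>\<^sup>s\<close> at \<open>s = d\<close> is minus weight times delay.\<close>

lemma trace_eq_mean_len: "- mat_trace (adj_mat I_minus_M * graph_matrix_deriv \<sigma> (of_nat DIM('a))) = complex_mean_len adj_row"
proof -
  have "mat_trace (adj_mat I_minus_M * graph_matrix_deriv \<sigma> (of_nat DIM('a)))
      = (\<Sum>i<n. \<Sum>j<n. adj_row j * graph_matrix_deriv \<sigma> (of_nat DIM('a)) $$ (j, i))"
    unfolding mat_trace_def using adj_carrier
    by (intro sum.cong) (auto simp: scalar_prod_def atLeast0LessThan graph_matrix_deriv_def adj_constant_columns)
  also have "\<dots> = (\<Sum>j<n. \<Sum>i<n. - (adj_row j * of_real (\<Sum>k<mult \<sigma> j i. weight j (i, k) * delay j (i, k))))"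
    by (subst sum.swap) (simp add: graph_matrix_deriv_entry)
  also have "\<dots> = - complex_mean_len adj_row"
    by (simp add: complex_mean_len_def sum_edges sum_negf sum_distrib_left)
  finally show ?thesis by simp
qed

lemma q_entry_eq:
  assumes h: "h < n"
  shows "q_entry \<sigma> h = Re (adj_row h / complex_mean_len adj_row)"
proof -
  have Q: "Q_matrix \<sigma> $$ (i, h) = of_real (Re (adj_row h / complex_mean_len adj_row))" if i: "i < n" for i
  proof -
    have "Q_matrix \<sigma> = (1 / complex_mean_len adj_row) \<cdot>\<^sub>m adj_mat I_minus_M"
      unfolding Q_matrix_def Let_def I_minus_M_def[symmetric] trace_eq_mean_len by (rule refl)
    then have "Q_matrix \<sigma> $$ (i, h) = adj_row h / complex_mean_len adj_row"
      using adj_carrier i h adj_constant_columns[OF i h] by simp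
    then show ?thesis using normalized_real[OF adj_row_stationary adj_row_nonzero, of h] h by simp
  qed
  show ?thesis
    unfolding q_entry_def
  proof (rule the_equality)
    fix q assume "\<forall>i<n. Q_matrix \<sigma> $$ (i, h) = complex_of_real q"
    then show "q = Re (adj_row h / complex_mean_len adj_row)" using Q[OF n_pos] n_pos by (metis of_real_eq_iff)
  qed (use Q in auto)
qed

end

section \<open>The covered volume\<close>

context incommensurable_tiling
begin

context
  fixes j :: nat and a b :: real
  assumes j: "j < n" and a: "0 \<le> a" and ab: "a < b" and b: "b \<le> 1"
begin

text \<open>A passage through the piece \<open>e\<close> of a tile of type \<open>i\<close> is counted when the time left on reaching
  that tile lies between \<open>lo i e\<close> and \<open>hi i e\<close>. The maxima cut the interval off at time zero: with no
  time left the tile is not substituted.\<close>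

definition lo :: "nat \<Rightarrow> nat \<times> nat \<Rightarrow> real" where
  "lo i e = ln (max a (const i e) / const i e)"

definition hi :: "nat \<Rightarrow> nat \<times> nat \<Rightarrow> real" where
  "hi i e = ln (max b (const i e) / const i e)"

definition type_edges :: "nat \<Rightarrow> (nat \<times> nat) set" where
  "type_edges i = {e \<in> edges i. fst e = j}"

definition counted :: "nat \<Rightarrow> nat \<times> nat \<Rightarrow> real \<Rightarrow> real" where
  "counted i e t = (if 0 < t \<and> t \<le> delay i e \<and> exp (t - delay i e) \<in> {a..b} then 1 else 0)"

text \<open>The probability that a tile of type \<open>i\<close> with time \<open>t\<close> left is followed immediately by a counted tile,
  in which the substitution stops.\<close>

definition source :: "nat \<Rightarrow> real \<Rightarrow> real" where
  "source i t = (\<Sum>e\<in>type_edges i. weight i e * counted i e t)"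

definition smoothed :: "(nat \<Rightarrow> nat \<times> nat \<Rightarrow> real \<Rightarrow> real) \<Rightarrow> nat \<Rightarrow> real \<Rightarrow> real" where
  "smoothed g i t = (\<Sum>e\<in>type_edges i. weight i e * g i e t)"

lemma finite_type_edges: "finite (type_edges i)"
  using finite_edges[of i] by (simp add: type_edges_def)

lemma type_edges_subset: "e \<in> type_edges i \<Longrightarrow> e \<in> edges i"
  by (simp add: type_edges_def)

lemma type_weights_le_1: "i < n \<Longrightarrow> (\<Sum>e\<in>type_edges i. weight i e) \<le> 1"
  using sum_mono2[of "edges i" "type_edges i" "weight i"] weights_sum_to_1[of i] finite_edges[of i] p_pos[of i]
  by (force simp: type_edges_def less_imp_le)

lemma weighted_sum_le:
  assumes i: "i < n" and c: "0 \<le> c" and le: "\<And>e. e \<in> type_edges i \<Longrightarrow> \<bar>x e\<bar> \<le> c"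
  shows "\<bar>\<Sum>e\<in>type_edges i. weight i e * x e\<bar> \<le> c"
proof -
  have "\<bar>\<Sum>e\<in>type_edges i. weight i e * x e\<bar> \<le> (\<Sum>e\<in>type_edges i. weight i e * c)"
  proof (intro order.trans[OF sum_abs] sum_mono)
    fix e assume e: "e \<in> type_edges i"
    have "0 < weight i e" using p_pos[of i e] i type_edges_subset[OF e] by simp
    then show "\<bar>weight i e * x e\<bar> \<le> weight i e * c" using le[OF e] by (simp add: abs_mult)
  qed
  also have "\<dots> = (\<Sum>e\<in>type_edges i. weight i e) * c" by (simp add: sum_distrib_right)
  also have "\<dots> \<le> 1 * c" using type_weights_le_1[OF i] c by (intro mult_right_mono)
  finally show ?thesis by simp
qed

lemma overshoot_window:
  assumes "i < n" "e \<in> edges i"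
  shows "0 \<le> lo i e" "lo i e \<le> hi i e" "hi i e \<le> delay i e"
    and "exp (lo i e) * const i e = max a (const i e)" "exp (hi i e) * const i e = max b (const i e)"
    and "hi i e - lo i e = ln (max b (const i e) / max a (const i e))"
proof -
  define c where "c = const i e"
  have c: "0 < c" "c < 1" using const_bounds[OF assms] by (auto simp: c_def)
  have pos: "0 < max a c" "0 < max b c" using c by auto
  then have ln: "lo i e = ln (max a c) - ln c" "hi i e = ln (max b c) - ln c"
    using c by (simp_all add: lo_def hi_def c_def[symmetric] ln_div)
  show "0 \<le> lo i e" "lo i e \<le> hi i e" using ln c pos ab by auto
  have "ln (max b c) \<le> ln 1" using pos c b by (intro ln_mono) auto
  then show "hi i e \<le> delay i e" using ln by (simp add: delay_def c_def)
  show "exp (lo i e) * const i e = max a (const i e)" "exp (hi i e) * const i e = max b (const i e)"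
    using c pos by (simp_all add: lo_def hi_def c_def[symmetric])
  show "hi i e - lo i e = ln (max b (const i e) / max a (const i e))"
    using ln pos by (simp add: ln_div c_def)
qed

text \<open>The function \<open>counted i e\<close> is the indicator of the interval from \<open>lo i e\<close> to \<open>hi i e\<close>, except possibly at
  the end points. There the inner trapezoid vanishes and the outer one equals one.\<close>

lemma counted_sandwich:
  assumes i: "i < n" and e: "e \<in> edges i" and \<epsilon>: "0 < \<epsilon>"
  shows "trapezoid (lo i e) (hi i e) \<epsilon> t \<le> counted i e t"
    and "counted i e t \<le> trapezoid (lo i e - \<epsilon>) (hi i e + \<epsilon>) \<epsilon> t"
proof -
  note w = overshoot_window[OF i e] and c = const_bounds[OF i e]
  have scale: "exp (t - delay i e) = exp t * const i e"
    using exp_delay[OF i e] exp_add[of t "- delay i e"] by simp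
  have bounds: "exp t * const i e < max b (const i e)" "max a (const i e) < exp t * const i e"
    if "lo i e < t" "t < hi i e"
    using mult_strict_right_mono[of "exp t" "exp (hi i e)" "const i e"]
      mult_strict_right_mono[of "exp (lo i e)" "exp t" "const i e"] that c w(4,5) by auto
  show "trapezoid (lo i e) (hi i e) \<epsilon> t \<le> counted i e t"
  proof (cases "lo i e < t \<and> t < hi i e")
    case True
    then have t: "0 < t" "t \<le> delay i e" using w(1,3) by auto
    have "const i e < exp t * const i e" using t(1) c by simp
    then have "exp t * const i e \<in> {a..b}" using bounds True by auto
    then have "counted i e t = 1" using t scale by (simp add: counted_def)
    then show ?thesis by (simp add: trapezoid_le_1)
  next
    case False
    then show ?thesis using trapezoid_outside[OF \<epsilon>, of t "lo i e" "hi i e"] by (auto simp: counted_def)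
  qed
  show "counted i e t \<le> trapezoid (lo i e - \<epsilon>) (hi i e + \<epsilon>) \<epsilon> t"
  proof (cases "counted i e t = 0")
    case True then show ?thesis by (simp add: trapezoid_nonneg)
  next
    case False
    then have t: "0 < t" "exp t * const i e \<in> {a..b}" using scale by (auto simp: counted_def split: if_splits)
    have "const i e < exp t * const i e" using t(1) c by simp
    then have "exp (lo i e) * const i e \<le> exp t * const i e" "exp t * const i e \<le> exp (hi i e) * const i e"
      unfolding w(4,5) using t(2) by auto
    then have "lo i e \<le> t" "t \<le> hi i e" using c by simp_all
    then have "trapezoid (lo i e - \<epsilon>) (hi i e + \<epsilon>) \<epsilon> t = 1" using \<epsilon> by (intro trapezoid_inside) auto
    then show ?thesis by (simp add: counted_def)
  qed
qed

lemma smoothed_test_fun: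
  assumes \<epsilon>: "0 < \<epsilon>"
    and lo': "\<And>i e. i < n \<Longrightarrow> e \<in> edges i \<Longrightarrow> -1 \<le> lo' i e"
    and hi': "\<And>i e. i < n \<Longrightarrow> e \<in> edges i \<Longrightarrow> hi' i e \<le> Max delays + 1"
  shows "test_fun (Max delays + 1) (1 / \<epsilon>) (smoothed (\<lambda>i e. trapezoid (lo' i e) (hi' i e) \<epsilon>))"
  unfolding test_fun_def
proof (intro conjI ballI allI impI)
  show "0 \<le> Max delays + 1" using lmax_pos[of 0] n_pos by simp
  show "0 \<le> 1 / \<epsilon>" using \<epsilon> by simp
next
  fix i t assume i: "i \<in> {..<n}" and t: "t < -1 \<or> Max delays + 1 < t"
  have "trapezoid (lo' i e) (hi' i e) \<epsilon> t = 0" if "e \<in> type_edges i" for e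
    using lo'[of i e] hi'[of i e] i type_edges_subset[OF that] t by (intro trapezoid_outside[OF \<epsilon>]) auto
  then show "smoothed (\<lambda>i e. trapezoid (lo' i e) (hi' i e) \<epsilon>) i t = 0" by (simp add: smoothed_def)
next
  fix i s t assume i: "i \<in> {..<n}"
  have "smoothed (\<lambda>i e. trapezoid (lo' i e) (hi' i e) \<epsilon>) i s - smoothed (\<lambda>i e. trapezoid (lo' i e) (hi' i e) \<epsilon>) i t
      = (\<Sum>e\<in>type_edges i. weight i e * (trapezoid (lo' i e) (hi' i e) \<epsilon> s - trapezoid (lo' i e) (hi' i e) \<epsilon> t))"
    by (simp add: smoothed_def right_diff_distrib sum_subtractf)
  also have "\<bar>\<dots>\<bar> \<le> \<bar>s - t\<bar> / \<epsilon>"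
    using i \<epsilon> by (intro weighted_sum_le trapezoid_lipschitz) auto
  finally show "\<bar>smoothed (\<lambda>i e. trapezoid (lo' i e) (hi' i e) \<epsilon>) i s
      - smoothed (\<lambda>i e. trapezoid (lo' i e) (hi' i e) \<epsilon>) i t\<bar> \<le> 1 / \<epsilon> * \<bar>s - t\<bar>"
    by simp
qed

lemma smoothed_mass:
  assumes \<epsilon>: "0 < \<epsilon>" and i: "i < n"
    and mass: "\<And>e. e \<in> edges i \<Longrightarrow>
      \<bar>integral UNIV (trapezoid (lo' i e) (hi' i e) \<epsilon>) - (hi i e - lo i e)\<bar> \<le> \<epsilon> * 2"
  shows "\<bar>integral UNIV (smoothed (\<lambda>i e. trapezoid (lo' i e) (hi' i e) \<epsilon>) i) - d_coeff \<sigma> i j a b\<bar> \<le> \<epsilon> * 2"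
proof -
  have "type_edges i = (\<lambda>k. (j, k)) ` {..<mult \<sigma> i j}"
    using j by (auto simp: type_edges_def piece_index_def)
  then have "(\<Sum>e\<in>type_edges i. weight i e * (hi i e - lo i e))
      = (\<Sum>k<mult \<sigma> i j. weight i (j, k) * (hi i (j, k) - lo i (j, k)))"
    by (simp add: sum.reindex inj_on_def)
  also have "\<dots> = d_coeff \<sigma> i j a b"
    unfolding d_coeff_def using i j
    by (intro sum.cong refl, subst overshoot_window(6)) (auto simp: piece_index_def weight_def const_def)
  finally have d: "(\<Sum>e\<in>type_edges i. weight i e * (hi i e - lo i e)) = d_coeff \<sigma> i j a b" .
  have "integral UNIV (smoothed (\<lambda>i e. trapezoid (lo' i e) (hi' i e) \<epsilon>) i)
      = (\<Sum>e\<in>type_edges i. weight i e * integral UNIV (trapezoid (lo' i e) (hi' i e) \<epsilon>))"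
    unfolding smoothed_def[abs_def]
    by (subst Henstock_Kurzweil_Integration.integral_sum)
       (auto intro!: finite_type_edges integrable_on_mult_right trapezoid_integrable \<epsilon>)
  then have "integral UNIV (smoothed (\<lambda>i e. trapezoid (lo' i e) (hi' i e) \<epsilon>) i) - d_coeff \<sigma> i j a b
      = (\<Sum>e\<in>type_edges i. weight i e * (integral UNIV (trapezoid (lo' i e) (hi' i e) \<epsilon>) - (hi i e - lo i e)))"
    unfolding d[symmetric] by (simp add: right_diff_distrib sum_subtractf)
  also have "\<bar>\<dots>\<bar> \<le> \<epsilon> * 2"
    using i \<epsilon> mass type_edges_subset by (intro weighted_sum_le) auto
  finally show ?thesis .
qed

lemma source_approximation:
  assumes \<epsilon>: "0 < \<epsilon>" "\<epsilon> \<le> 1"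
  shows "\<exists>c K zl zu. test_fun c K zl \<and> test_fun c K zu \<and>
    (\<forall>i\<in>{..<n}. (\<forall>t. zl i t \<le> source i t \<and> source i t \<le> zu i t) \<and>
      \<bar>integral UNIV (zl i) - d_coeff \<sigma> i j a b\<bar> \<le> \<epsilon> * 2 \<and>
      \<bar>integral UNIV (zu i) - d_coeff \<sigma> i j a b\<bar> \<le> \<epsilon> * 2)"
proof -
  define zl where "zl = smoothed (\<lambda>i e. trapezoid (lo i e) (hi i e) \<epsilon>)"
  define zu where "zu = smoothed (\<lambda>i e. trapezoid (lo i e - \<epsilon>) (hi i e + \<epsilon>) \<epsilon>)"
  have window: "0 \<le> lo i e" "lo i e \<le> hi i e" "hi i e \<le> Max delays" if "i < n" "e \<in> edges i" for i e
    using overshoot_window[OF that] len_le[of i e] that by auto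
  have "test_fun (Max delays + 1) (1 / \<epsilon>) zl"
    unfolding zl_def using window by (intro smoothed_test_fun \<epsilon>(1)) fastforce+
  moreover have "test_fun (Max delays + 1) (1 / \<epsilon>) zu"
    unfolding zu_def
  proof (rule smoothed_test_fun[OF \<epsilon>(1)])
    fix i e assume "i < n" "e \<in> edges i"
    then show "-1 \<le> lo i e - \<epsilon>" "hi i e + \<epsilon> \<le> Max delays + 1" using window[of i e] \<epsilon> by auto
  qed
  moreover have "zl i t \<le> source i t \<and> source i t \<le> zu i t" if "i < n" for i t
    unfolding zl_def zu_def source_def smoothed_def
    using counted_sandwich[OF that type_edges_subset \<epsilon>(1)] p_pos[of i] type_edges_subset that
    by (intro conjI sum_mono mult_left_mono) (auto simp: less_imp_le)
  moreover have "\<bar>integral UNIV (zl i) - d_coeff \<sigma> i j a b\<bar> \<le> \<epsilon> * 2" if "i < n" for i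
    unfolding zl_def
  proof (rule smoothed_mass[OF \<epsilon>(1) that])
    fix e assume "e \<in> edges i"
    then show "\<bar>integral UNIV (trapezoid (lo i e) (hi i e) \<epsilon>) - (hi i e - lo i e)\<bar> \<le> \<epsilon> * 2"
      using integral_trapezoid[OF \<epsilon>(1), of "lo i e" "hi i e"] window[of i e] that \<epsilon> by (simp add: abs_le_iff)
  qed
  moreover have "\<bar>integral UNIV (zu i) - d_coeff \<sigma> i j a b\<bar> \<le> \<epsilon> * 2" if "i < n" for i
    unfolding zu_def
  proof (rule smoothed_mass[OF \<epsilon>(1) that])
    fix e assume "e \<in> edges i"
    then show "\<bar>integral UNIV (trapezoid (lo i e - \<epsilon>) (hi i e + \<epsilon>) \<epsilon>) - (hi i e - lo i e)\<bar> \<le> \<epsilon> * 2"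
      using integral_trapezoid[OF \<epsilon>(1), of "lo i e - \<epsilon>" "hi i e + \<epsilon>"] window[of i e] that \<epsilon>
      by (simp add: abs_le_iff)
  qed
  ultimately show ?thesis by (metis lessThan_iff)
qed

lemma source_vanishes: "t \<le> 0 \<Longrightarrow> source i t = 0"
  by (simp add: source_def counted_def)

text \<open>The covered fraction solves the homogeneous renewal equation for positive times with initial values
  at nonpositive times. Moving the contribution of the initial values into the source leaves a function
  that vanishes at nonpositive times and solves the inhomogeneous equation everywhere.\<close>

lemma covered_volume_renewal:
  assumes i: "i < n" and t: "0 < t"
  shows "covered_volume \<sigma> i j a b t = exp (real DIM('a) * t) * potential source i t"
proof -
  \<comment> \<open>A tile of volume at most one is never substituted: it is counted at once or not at all.\<close>
  define ini where "ini i t = (if t \<le> 0 \<and> i = j \<and> exp t \<in> {a..b} then 1 else 0 :: real)" for i t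
  define W where "W i t = potential source i t + ini i t" for i t
  have src0: "source i t = 0" if "t < 0" for i t using source_vanishes[of t i] that by simp
  have eq: "potential source i t = source i t + transfer (potential source) i t" if "i < n" for i t
    using renewal_equation[of 0 source i t] src0 that by simp
  have neg: "potential source i t = 0" if "i < n" "t < 0" for i t
    using potential_vanishes[of 0 source i t] src0 that by simp
  have zero: "potential source i t = 0" if g: "i < n" "t \<le> 0" for i t
  proof -
    have "potential source (fst e) (t - delay i e) = 0" if "e \<in> edges i" for e
      using neg edge_target[OF that] len_ge[of i e] lmin_pos that g by simp
    then show ?thesis using eq[OF g(1)] source_vanishes[OF g(2)] by (simp add: transfer_apply)
  qed
  have source_eq: "source i t = transfer ini i t" if g: "i < n" "0 < t" for i t
  proof -
    have "transfer ini i t = (\<Sum>e\<in>edges i. if fst e = j then weight i e * counted i e t else 0)"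
      unfolding transfer_apply using g(2) by (intro sum.cong) (auto simp: ini_def counted_def)
    also have "\<dots> = source i t"
      using finite_edges by (simp add: source_def type_edges_def sum.inter_filter)
    finally show ?thesis by simp
  qed
  have "covered_volume \<sigma> i j a b t = exp (real DIM('a) * t) * W i t"
  proof (rule covered_volume_eq[OF _ _ i])
    fix i t assume "i < n" "t \<le> (0::real)"
    then show "W i t = (if i = j \<and> exp t \<in> {a..b} then 1 else 0)" using zero by (simp add: W_def ini_def)
  next
    fix i t assume g: "i < n" "(0::real) < t"
    have "W i t = transfer (potential source) i t + transfer ini i t"
      using eq[OF g(1)] source_eq[OF g] g(2) by (simp add: W_def ini_def)
    also have "\<dots> = transfer W i t" by (simp add: transfer_apply W_def distrib_left sum.distrib)
    finally show "W i t = transfer W i t" .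
  qed
  then show ?thesis using t by (simp add: W_def ini_def)
qed

theorem covered_fraction_tendsto:
  assumes i: "i < n"
  shows "((\<lambda>t. covered_volume \<sigma> i j a b t / exp (real DIM('a) * t)) \<longlongrightarrow> nu_coeff \<sigma> j a b) at_top"
proof -
  have "(potential source i \<longlongrightarrow> (\<Sum>h<n. Re (adj_row h / complex_mean_len adj_row) * d_coeff \<sigma> h j a b)) at_top"
  proof (rule key_renewal_sandwich[OF adj_row_stationary adj_row_nonzero, where z = source and C = 2])
    fix g t assume "g \<in> {..<n}"
    then show "potential source g t = source g t + transfer (potential source) g t"
      using renewal_equation[of 0 source g t] source_vanishes by simp
  next
    fix g t assume "g \<in> {..<n}" "t < (-1::real)"
    then show "potential source g t = 0" using potential_vanishes[of 0 source g t] source_vanishes by simp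
  qed (use i source_approximation in auto)
  also have "(\<Sum>h<n. Re (adj_row h / complex_mean_len adj_row) * d_coeff \<sigma> h j a b) = nu_coeff \<sigma> j a b"
    unfolding nu_coeff_def by (intro sum.cong refl) (simp add: q_entry_eq)
  finally have "(potential source i \<longlongrightarrow> nu_coeff \<sigma> j a b) at_top" .
  moreover have "\<forall>\<^sub>F t in at_top. potential source i t = covered_volume \<sigma> i j a b t / exp (real DIM('a) * t)"
    using eventually_gt_at_top[of 0] by eventually_elim (simp add: covered_volume_renewal i)
  ultimately show ?thesis by (rule Lim_transform_eventually)
qed

end

end

theorem theorem7p10:
  fixes \<sigma> :: "'a::euclidean_space scheme" and i j :: nat and a b :: real
  assumes "multiscale_scheme \<sigma>"
    and "normalized_scheme \<sigma>"
    and "geometrically_distinct \<sigma>"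
    and "irreducible_scheme \<sigma>"
    and "incommensurable_scheme \<sigma>"
    and "i < nprotos \<sigma>" and "j < nprotos \<sigma>"
    and "0 \<le> a" and "a < b" and "b \<le> 1"
  shows "(\<lambda>t::real. covered_volume \<sigma> i j a b t - nu_coeff \<sigma> j a b * exp (real DIM('a) * t))
           \<in> o[at_top](\<lambda>t. exp (real DIM('a) * t))"
proof -
  interpret incommensurable_tiling \<sigma> using assms by unfold_locales
  let ?g = "\<lambda>t::real. exp (real DIM('a) * t)"
  have "((\<lambda>t. covered_volume \<sigma> i j a b t / ?g t - nu_coeff \<sigma> j a b) \<longlongrightarrow> 0) at_top"
    using covered_fraction_tendsto[OF assms(7-10,6)] by (simp add: LIM_zero_iff)
  then have "((\<lambda>t. (covered_volume \<sigma> i j a b t - nu_coeff \<sigma> j a b * ?g t) / ?g t) \<longlongrightarrow> 0) at_top"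
    by (simp add: diff_divide_distrib)
  then show ?thesis by (intro smalloI_tendsto) simp_all
qed

end
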